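(* Let $(\bar N,g)$ be an $n$-dimensional Riemannian manifold isometrically embedded in $\mathbb{R}^S$, $N\subset\bar N$ compact, and $1\le m\le n-1$. The following are equivalent: (i) $N$ contains no non-zero $m$-varifold with null generalized second fundamental form; (ii) there exist an increasing function $\Phi:[0,\infty)\to[0,\infty)$ with $\Phi(0)=0$ and a function $F:G_m(N)\times\mathbb{R}^{S^3}\to[0,\infty)$ satisfying condition (F) such that every $m$-varifold $V$ on $N$ with generalized second fundamental form $A$ satisfies $|V|\le\Phi\big(\int_{G_m(N)}F(x,P,A)\,dV\big)$; (iii) for every $F:G_m(N)\times\mathbb{R}^{S^3}\to[0,\infty)$ satisfying condition (F) there is $C_F>0$ such that every $m$-varifold $V$ on $N$ with generalized second fundamental form $A$ satisfies $|V|\le C_F\int_{G_m(N)}F(x,P,A)\,dV$.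
   Context: $G(S,m)$ is the Grassmannian of $m$-planes in $\mathbb{R}^S$, each $P$ identified with its orthogonal projection matrix $(P_{ij})$; $Q(x)=(Q_{ij}(x))$ is the orthogonal projection onto $T_x\bar N$; $G_m(N)=\{(x,P):x\in N,\ P\subset T_x\bar N\}$. An $m$-varifold on $N$ is any Radon measure $V$ on $G_m(N)$ (not necessarily rectifiable); $|V|=V(G_m(N))$. $V$ has generalized curvature $B=(B_{ijk})$, $B_{ijk}\in L^1_{loc}(V)$, if for all $\phi\in C^1_c(\mathbb{R}^S\times\mathbb{R}^{S\times S})$ and each $i$: $0=\int_{G_m(N)}[P_{ij}D_j\phi+B_{ijk}D^*_{jk}\phi+B_{jij}\phi]\,dV$ (summation convention; $D_j$ derivative in $x_j$, $D^*_{jk}$ derivative in $P_{jk}$); its generalized second fundamental form is $A^k_{ij}=P_{lj}B_{ikl}-P_{lj}P_{iq}\partial_{x_q}Q_{kl}(x)$. Condition (F) on $F:G_m(N)\times\mathbb{R}^\alpha\to\mathbb{R}$: (i) continuous; (ii) $F\ge0$, and $F(x,P,q)=0$ iff $q=0$; (iii) convex in $q$; (iv) there is a continuous $\phi:G_m(N)\times[0,\infty)\to[0,\infty)$, nondecreasing in the last variable, with $\phi(x,P,t)\to\infty$ locally uniformly as $t\to\infty$, such that $\phi(x,P,|q|)|q|\le F(x,P,q)$. *)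

theory Defs
  imports "HOL-Analysis.Analysis"
begin

primrec Ck_on :: "nat \<Rightarrow> 'a::euclidean_space set \<Rightarrow> ('a \<Rightarrow> 'b::real_normed_vector) \<Rightarrow> bool" where
  "Ck_on 0 W f = continuous_on W f"
| "Ck_on (Suc k) W f =
     ((\<forall>x\<in>W. f differentiable (at x)) \<and>
      (\<forall>v. Ck_on k W (\<lambda>x. frechet_derivative f (at x) v)))"

definition smooth_on :: "'a::euclidean_space set \<Rightarrow> ('a \<Rightarrow> 'b::real_normed_vector) \<Rightarrow> bool" where
  "smooth_on W f \<longleftrightarrow> (\<forall>k. Ck_on k W f)"

definition embedded_submanifold :: "'n::finite itself \<Rightarrow> (real^'s) set \<Rightarrow> bool" where
  "embedded_submanifold _ M \<longleftrightarrow>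
     (\<forall>p\<in>M. \<exists>U (W::(real^'n) set) (\<phi>::real^'n \<Rightarrow> real^'s).
        open U \<and> p \<in> U \<and> open W \<and> smooth_on W \<phi> \<and> \<phi> ` W = M \<inter> U \<and> inj_on \<phi> W \<and>
        continuous_on (M \<inter> U) (inv_into W \<phi>) \<and>
        (\<forall>u\<in>W. inj (frechet_derivative \<phi> (at u))))"

definition tangent_space :: "(real^'s) set \<Rightarrow> real^'s \<Rightarrow> (real^'s) set" where
  "tangent_space M x = {v. \<exists>\<gamma> e. e > 0 \<and> (\<forall>t\<in>{-e<..<e}. \<gamma> t \<in> M) \<and> \<gamma> 0 = x \<and>
                               (\<gamma> has_vector_derivative v) (at 0)}"

definition is_orth_proj :: "(real^'s) set \<Rightarrow> real^'s^'s \<Rightarrow> bool" where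
  "is_orth_proj T P \<longleftrightarrow> transpose P = P \<and> P ** P = P \<and> range (\<lambda>v. P *v v) = T"

text \<open>Grassmannian G(S,m) of m-planes, as orthogonal projection matrices.\<close>
definition Grass :: "nat \<Rightarrow> (real^'s^'s) set" where
  "Grass m = {P. transpose P = P \<and> P ** P = P \<and> rank P = m}"

definition Gm :: "nat \<Rightarrow> (real^'s) set \<Rightarrow> (real^'s) set \<Rightarrow> ((real^'s) \<times> (real^'s^'s)) set" where
  "Gm m Nbar N = {(x, P). x \<in> N \<and> P \<in> Grass m \<and> range (\<lambda>v. P *v v) \<subseteq> tangent_space Nbar x}"

text \<open>An m-varifold on N: a Radon (= finite Borel, G_m(N) being compact) measure carried by G_m(N).\<close>
definition varifold :: "nat \<Rightarrow> (real^'s) set \<Rightarrow> (real^'s) set \<Rightarrow> ((real^'s) \<times> (real^'s^'s)) measure \<Rightarrow> bool" where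
  "varifold m Nbar N V \<longleftrightarrow> sets V = sets borel \<and> emeasure V (space V) < \<infinity> \<and>
     emeasure V (space V - Gm m Nbar N) = 0"

definition C1c :: "((real^'s) \<times> (real^'s^'s) \<Rightarrow> real) \<Rightarrow> bool" where
  "C1c \<phi> \<longleftrightarrow> Ck_on 1 UNIV \<phi> \<and> compact (closure {z. \<phi> z \<noteq> 0})"

definition Dx :: "((real^'s) \<times> (real^'s^'s) \<Rightarrow> real) \<Rightarrow> 's \<Rightarrow> (real^'s) \<times> (real^'s^'s) \<Rightarrow> real" where
  "Dx \<phi> j z = frechet_derivative \<phi> (at z) (axis j 1, 0)"

definition DP :: "((real^'s) \<times> (real^'s^'s) \<Rightarrow> real) \<Rightarrow> 's \<Rightarrow> 's \<Rightarrow> (real^'s) \<times> (real^'s^'s) \<Rightarrow> real" where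
  "DP \<phi> j k z = frechet_derivative \<phi> (at z) (0, axis j (axis k 1))"

definition gen_curvature :: "((real^'s) \<times> (real^'s^'s)) measure \<Rightarrow>
    ((real^'s) \<times> (real^'s^'s) \<Rightarrow> real^'s^'s^'s) \<Rightarrow> bool" where
  "gen_curvature V B \<longleftrightarrow>
     (\<forall>i j k. integrable V (\<lambda>z. B z $ i $ j $ k)) \<and>
     (\<forall>\<phi> i. C1c \<phi> \<longrightarrow>
        (\<integral>z. (\<Sum>j\<in>UNIV. (snd z) $ i $ j * Dx \<phi> j z)
             + (\<Sum>j\<in>UNIV. \<Sum>k\<in>UNIV. B z $ i $ j $ k * DP \<phi> j k z)
             + (\<Sum>j\<in>UNIV. B z $ j $ i $ j) * \<phi> z \<partial>V) = 0)"

text \<open>Generalized second fundamental form: (sff Q B z) $ i $ j $ k = A^k_ij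
  = P_lj B_ikl - P_lj P_iq \<partial>_q Q_kl(x).\<close>
definition sff :: "(real^'s \<Rightarrow> real^'s^'s) \<Rightarrow> ((real^'s) \<times> (real^'s^'s) \<Rightarrow> real^'s^'s^'s) \<Rightarrow>
    (real^'s) \<times> (real^'s^'s) \<Rightarrow> real^'s^'s^'s" where
  "sff Q B z = (\<chi> i j k. (\<Sum>l\<in>UNIV. (snd z) $ l $ j * B z $ i $ k $ l)
      - (\<Sum>l\<in>UNIV. \<Sum>q\<in>UNIV. (snd z) $ l $ j * (snd z) $ i $ q *
            (frechet_derivative Q (at (fst z)) (axis q 1)) $ k $ l))"

definition condF :: "((real^'s) \<times> (real^'s^'s)) set \<Rightarrow>
    ((real^'s) \<times> (real^'s^'s) \<Rightarrow> real^'s^'s^'s \<Rightarrow> real) \<Rightarrow> bool" where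
  "condF G F \<longleftrightarrow>
     continuous_on (G \<times> UNIV) (\<lambda>(z, q). F z q) \<and>
     (\<forall>z\<in>G. \<forall>q. F z q \<ge> 0 \<and> (F z q = 0 \<longleftrightarrow> q = 0)) \<and>
     (\<forall>z\<in>G. convex_on UNIV (F z)) \<and>
     (\<exists>\<psi> :: (real^'s) \<times> (real^'s^'s) \<Rightarrow> real \<Rightarrow> real.
        continuous_on (G \<times> {0..}) (\<lambda>(z, t). \<psi> z t) \<and>
        (\<forall>z\<in>G. \<forall>t\<ge>0. \<psi> z t \<ge> 0) \<and>
        (\<forall>z\<in>G. mono_on {0..} (\<psi> z)) \<and>
        (\<forall>z0\<in>G. \<exists>e>0. \<forall>M. \<exists>T. \<forall>t\<ge>T. \<forall>z\<in>G \<inter> ball z0 e. \<psi> z t \<ge> M) \<and>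
        (\<forall>z\<in>G. \<forall>q. \<psi> z (norm q) * norm q \<le> F z q))"

end

theory Submission
  imports Defs "HOL-Probability.Probability"
begin

text \<open>
  The substantial implication is from (i) to (iii). Testing the curvature identity with functions that
  vanish on the Grassmannian shows that a curvature \<open>B\<close> is, almost everywhere, symmetric and a derivation
  with respect to \<open>P\<close>. It is therefore determined by the second fundamental form \<open>A\<close>, and differs from the
  curvature \<open>H(x, P)\<close> that corresponds to \<open>A = 0\<close> by at most \<open>2|A|\<close>. Convexity and compactness give
  \<open>|q| \<le> \<epsilon> + C\<^sub>\<epsilon> F(z, q)\<close>. If (iii) fails for \<open>F\<close>, there are thus varifolds of mass one whose curvatures
  approach the fixed continuous function \<open>H\<close> in \<open>L\<^sup>1\<close>, and the curvature identity with \<open>H\<close> passes to a weak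
  limit. As \<open>P (\<partial>\<^sub>v Q) P = 0\<close> for \<open>v\<close> tangent to \<open>Nbar\<close>, the second fundamental form of the limit vanishes,
  contradicting (i).

  Weak compactness of probability measures on a compact subset of a Euclidean space is reduced to Helly's
  theorem by lifting the measures to the line through Schoenberg's space-filling curve.
\<close>

section \<open>Schoenberg's space-filling curve\<close>

definition cantor_point :: "(nat \<Rightarrow> bool) \<Rightarrow> real" where
  "cantor_point d = (\<Sum>n. 2 * of_bool (d n) * (1/3) ^ Suc n)"

lemma summable_cantor_point: "summable (\<lambda>n. 2 * of_bool (d n) * (1/3 :: real) ^ Suc n)"
proof (rule summable_comparison_test')
  show "summable (\<lambda>n. 2/3 * (1/3 :: real) ^ n)"
    by (intro summable_mult summable_geometric) auto
qed auto

lemma cantor_point_nonneg: "0 \<le> cantor_point d"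
  unfolding cantor_point_def by (intro suminf_nonneg summable_cantor_point) simp

lemma cantor_point_le_1: "cantor_point d \<le> 1"
proof -
  have geometric: "(\<lambda>n. 2/3 * (1/3 :: real) ^ n) sums (2/3 * (1 / (1 - 1/3)))"
    by (intro sums_mult geometric_sums) auto
  have "cantor_point d \<le> (\<Sum>n. 2/3 * (1/3) ^ n)"
    unfolding cantor_point_def
    by (intro suminf_le summable_cantor_point sums_summable[OF geometric]) auto
  also have "\<dots> = 1"
    using sums_unique[OF geometric] by simp
  finally show ?thesis .
qed

lemma cantor_point_split_head:
  "cantor_point d = (2 * of_bool (d 0) + cantor_point (\<lambda>n. d (Suc n))) / 3"
proof -
  have "(\<Sum>n. 2 * of_bool (d (Suc n)) * (1/3 :: real) ^ Suc (Suc n)) = cantor_point (\<lambda>n. d (Suc n)) / 3"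
    using suminf_divide[OF summable_cantor_point, of "\<lambda>n. d (Suc n)" 3]
    by (simp add: cantor_point_def)
  then show ?thesis
    using suminf_split_head[OF summable_cantor_point, of d] by (simp add: cantor_point_def)
qed

definition schoenberg_wave :: "real \<Rightarrow> real" where
  "schoenberg_wave t = max 0 (min 1 (1/2 - cos (pi * t)))"

lemma schoenberg_wave_bounds: "0 \<le> schoenberg_wave t" "schoenberg_wave t \<le> 1"
  by (auto simp: schoenberg_wave_def)

lemma continuous_on_schoenberg_wave [continuous_intros]:
  "continuous_on S f \<Longrightarrow> continuous_on S (\<lambda>x. schoenberg_wave (f x))"
  for f :: "'a::t2_space \<Rightarrow> real"
  unfolding schoenberg_wave_def by (intro continuous_intros)

lemma schoenberg_wave_periodic: "schoenberg_wave (t + 2 * real k) = schoenberg_wave t"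
proof -
  have "pi * (t + 2 * real k) = pi * t + real k * (2 * pi)"
    by (simp add: algebra_simps)
  then show ?thesis
    unfolding schoenberg_wave_def using cos.plus_of_nat[of "pi * t" k] by simp
qed

lemma schoenberg_wave_outer_thirds:
  assumes "0 \<le> s" "s \<le> 1"
  shows "schoenberg_wave ((2 * of_bool b + s) / 3) = of_bool b"
proof (cases b)
  case False
  have "cos (pi / 3) \<le> cos (pi * (s / 3))"
    using assms by (intro cos_monotone_0_pi_le) (auto simp: mult_left_le)
  then show ?thesis
    using False by (simp add: schoenberg_wave_def cos_60)
next
  case True
  have "cos (pi * ((2 + s) / 3)) \<le> cos (2 * pi / 3)"
    using assms by (intro cos_monotone_0_pi_le) (auto simp: field_simps)
  also have "\<dots> = - (1/2)"
    using cos_120 by simp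
  finally show ?thesis
    using True by (simp add: schoenberg_wave_def)
qed

lemma schoenberg_wave_cantor_point: "schoenberg_wave (3 ^ m * cantor_point d) = of_bool (d m)"
proof (induction m arbitrary: d)
  case 0
  show ?case
    by (subst cantor_point_split_head)
      (use schoenberg_wave_outer_thirds[OF cantor_point_nonneg cantor_point_le_1] in simp)
next
  case (Suc m)
  have "3 ^ Suc m * cantor_point d = 3 ^ m * cantor_point (\<lambda>n. d (Suc n)) + 2 * real (3 ^ m * of_bool (d 0))"
    by (subst cantor_point_split_head) (simp add: algebra_simps)
  then show ?case
    using Suc.IH[of "\<lambda>n. d (Suc n)"] by (simp only: schoenberg_wave_periodic)
qed

definition binary_digit :: "nat \<Rightarrow> real \<Rightarrow> bool" where
  "binary_digit n x \<longleftrightarrow> odd \<lfloor>2 ^ Suc n * x\<rfloor>"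

lemma measurable_binary_digit [measurable]: "Measurable.pred borel (binary_digit n)"
proof -
  have "(\<lambda>x::real. \<lfloor>2 ^ Suc n * x\<rfloor>) \<in> measurable borel (count_space UNIV)"
    by measurable
  then show ?thesis
    unfolding binary_digit_def[abs_def] by (rule measurable_compose) simp
qed

lemma floor_power2_Suc: "\<lfloor>2 ^ Suc n * x\<rfloor> = 2 * \<lfloor>2 ^ n * x\<rfloor> + of_bool (binary_digit n x)" for x :: real
proof -
  have "\<lfloor>2 ^ Suc n * x\<rfloor> div 2 = \<lfloor>2 ^ n * x\<rfloor>"
    using floor_divide_real_eq_div[of 2 "2 ^ Suc n * x"] by simp
  then show ?thesis
    using mult_div_mod_eq[of 2 "\<lfloor>2 ^ Suc n * x\<rfloor>"]
    unfolding binary_digit_def mod_2_eq_odd by simp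
qed

lemma dyadic_floor_tendsto: "(\<lambda>n. of_int \<lfloor>2 ^ n * x\<rfloor> / 2 ^ n) \<longlonglongrightarrow> x" for x :: real
proof (rule tendsto_sandwich)
  show "\<forall>\<^sub>F n in sequentially. of_int \<lfloor>2 ^ n * x\<rfloor> / 2 ^ n \<le> x"
    by (simp add: divide_le_eq mult.commute)
  have "x - (1/2) ^ n \<le> of_int \<lfloor>2 ^ n * x\<rfloor> / 2 ^ n" for n
  proof -
    have "2 ^ n * x - 1 \<le> of_int \<lfloor>2 ^ n * x\<rfloor>"
      by linarith
    then have "(2 ^ n * x - 1) / 2 ^ n \<le> of_int \<lfloor>2 ^ n * x\<rfloor> / 2 ^ n"
      by (rule divide_right_mono) simp
    then show ?thesis
      by (simp add: diff_divide_distrib power_divide)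
  qed
  then show "\<forall>\<^sub>F n in sequentially. x - (1/2) ^ n \<le> of_int \<lfloor>2 ^ n * x\<rfloor> / 2 ^ n"
    by simp
  have "(\<lambda>n. x - (1/2) ^ n) \<longlonglongrightarrow> x - 0"
    by (intro tendsto_intros LIMSEQ_power_zero) auto
  then show "(\<lambda>n. x - (1/2) ^ n) \<longlonglongrightarrow> x"
    by simp
qed auto

lemma binary_expansion:
  assumes "0 \<le> x" "x < 1"
  shows "(\<lambda>n. (1/2) ^ Suc n * of_bool (binary_digit n x)) sums x"
proof -
  have "of_int \<lfloor>2 ^ Suc n * x\<rfloor> / 2 ^ Suc n - of_int \<lfloor>2 ^ n * x\<rfloor> / 2 ^ n
      = (1/2 :: real) ^ Suc n * of_bool (binary_digit n x)" for n
    unfolding floor_power2_Suc by (simp add: field_simps)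
  moreover have "\<lfloor>x\<rfloor> = 0"
    using assms by (simp add: floor_eq_iff)
  ultimately show ?thesis
    using telescope_sums[OF dyadic_floor_tendsto[of x]] by (simp del: power_Suc)
qed

text \<open>The pairing function distributes the ternary digits of the parameter over countably many
  coordinates, each receiving them as its binary digits.\<close>

definition schoenberg_coord :: "nat \<Rightarrow> real \<Rightarrow> real" where
  "schoenberg_coord i t = (\<Sum>n. (1/2) ^ Suc n * schoenberg_wave (3 ^ prod_encode (n, i) * t))"

lemma continuous_on_schoenberg_coord: "continuous_on UNIV (schoenberg_coord i)"
proof -
  have "uniform_limit UNIV (\<lambda>n t. \<Sum>k<n. (1/2) ^ Suc k * schoenberg_wave (3 ^ prod_encode (k, i) * t))
      (schoenberg_coord i) sequentially"
    unfolding schoenberg_coord_def[abs_def]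
  proof (rule Weierstrass_m_test)
    show "norm ((1/2) ^ Suc n * schoenberg_wave (3 ^ prod_encode (n, i) * t)) \<le> (1/2) ^ Suc n" for n t
      using schoenberg_wave_bounds[of "3 ^ prod_encode (n, i) * t"] by (simp add: abs_mult)
    show "summable (\<lambda>n. (1/2 :: real) ^ Suc n)"
      using power_half_series by (rule sums_summable)
  qed
  then show ?thesis
    by (rule uniform_limit_theorem[rotated]) (auto intro!: always_eventually continuous_intros)
qed

definition interleaved_binary_digits :: "(nat \<Rightarrow> real) \<Rightarrow> nat \<Rightarrow> bool" where
  "interleaved_binary_digits p k = (case prod_decode k of (n, i) \<Rightarrow> binary_digit n (p i))"

lemma schoenberg_coord_interleaved_binary_digits:
  assumes "0 \<le> p i" "p i < 1"
  shows "schoenberg_coord i (cantor_point (interleaved_binary_digits p)) = p i"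
  using sums_unique[OF binary_expansion[OF assms]]
  by (simp add: schoenberg_coord_def schoenberg_wave_cantor_point interleaved_binary_digits_def)

definition schoenberg_curve :: "real \<Rightarrow> 'a::euclidean_space" where
  "schoenberg_curve t = (\<Sum>b\<in>Basis. schoenberg_coord (to_nat_on Basis b) t *\<^sub>R b)"

definition schoenberg_parameter :: "'a::euclidean_space \<Rightarrow> real" where
  "schoenberg_parameter x = cantor_point (interleaved_binary_digits (\<lambda>i. x \<bullet> from_nat_into Basis i))"

lemma continuous_on_schoenberg_curve: "continuous_on UNIV schoenberg_curve"
  unfolding schoenberg_curve_def[abs_def] by (intro continuous_intros continuous_on_schoenberg_coord)

lemma measurable_schoenberg_parameter [measurable]: "schoenberg_parameter \<in> borel_measurable borel"
proof -
  have "Measurable.pred borel (\<lambda>x::'a. interleaved_binary_digits (\<lambda>i. x \<bullet> from_nat_into Basis i) k)" for k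
    unfolding interleaved_binary_digits_def by (cases "prod_decode k") simp
  then show ?thesis
    unfolding schoenberg_parameter_def[abs_def] cantor_point_def by measurable
qed

lemma schoenberg_parameter_in: "schoenberg_parameter x \<in> {0..1}"
  by (simp add: schoenberg_parameter_def cantor_point_nonneg cantor_point_le_1)

lemma schoenberg_curve_parameter:
  fixes x :: "'a::euclidean_space"
  assumes "\<And>b. b \<in> Basis \<Longrightarrow> 0 \<le> x \<bullet> b" "\<And>b. b \<in> Basis \<Longrightarrow> x \<bullet> b < 1"
  shows "schoenberg_curve (schoenberg_parameter x) = x"
proof -
  have "schoenberg_coord (to_nat_on Basis b) (schoenberg_parameter x) = x \<bullet> b" if "b \<in> Basis" for b :: 'a
    using schoenberg_coord_interleaved_binary_digits[of "\<lambda>i. x \<bullet> from_nat_into Basis i" "to_nat_on Basis b"]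
      assms[OF that] that
    by (simp add: schoenberg_parameter_def countable_finite)
  then show ?thesis
    by (simp add: schoenberg_curve_def euclidean_representation)
qed

lemma continuous_curve_with_measurable_section:
  fixes K :: "'a::euclidean_space set"
  assumes "bounded K"
  obtains f :: "real \<Rightarrow> 'a" and \<sigma> :: "'a \<Rightarrow> real"
  where "continuous_on UNIV f" "\<sigma> \<in> borel_measurable borel" "range \<sigma> \<subseteq> {0..1}"
    "\<And>x. x \<in> K \<Longrightarrow> f (\<sigma> x) = x"
proof -
  obtain R where R: "R > 0" "\<And>x. x \<in> K \<Longrightarrow> norm x < R"
    using assms by (meson bounded_pos_less)
  define to_cube where "to_cube x = (1 / (2 * R)) *\<^sub>R (x + R *\<^sub>R One)" for x :: 'a
  define from_cube where "from_cube y = (2 * R) *\<^sub>R y - R *\<^sub>R One" for y :: 'a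
  show thesis
  proof (rule that[of "from_cube \<circ> schoenberg_curve" "schoenberg_parameter \<circ> to_cube"])
    show "continuous_on UNIV (from_cube \<circ> schoenberg_curve)"
      unfolding from_cube_def o_def by (intro continuous_intros continuous_on_schoenberg_curve)
    show "schoenberg_parameter \<circ> to_cube \<in> borel_measurable borel"
      unfolding to_cube_def o_def by measurable
    show "range (schoenberg_parameter \<circ> to_cube) \<subseteq> {0..1}"
      using schoenberg_parameter_in by (auto simp del: atLeastAtMost_iff)
    fix x assume "x \<in> K"
    have "0 \<le> to_cube x \<bullet> b \<and> to_cube x \<bullet> b < 1" if "b \<in> Basis" for b
    proof -
      have "\<bar>x \<bullet> b\<bar> < R"
        using Basis_le_norm[OF that, of x] R(2)[OF \<open>x \<in> K\<close>] by linarith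
      then show ?thesis
        using R(1) that by (auto simp: to_cube_def inner_add_left field_simps)
    qed
    then have "schoenberg_curve (schoenberg_parameter (to_cube x)) = to_cube x"
      by (intro schoenberg_curve_parameter) auto
    then show "(from_cube \<circ> schoenberg_curve) ((schoenberg_parameter \<circ> to_cube) x) = x"
      using R(1) by (simp add: from_cube_def to_cube_def)
  qed
qed

section \<open>Measures carried by a compact set\<close>

lemma linear_family_bound:
  fixes L :: "'a::topological_space \<Rightarrow> 'b::euclidean_space \<Rightarrow> 'c::real_normed_vector"
  assumes K: "compact K" and cont: "continuous_on (K \<times> UNIV) (\<lambda>(x, q). L x q)"
    and linear: "\<And>x. x \<in> K \<Longrightarrow> linear (L x)"
  obtains C where "\<And>x q. x \<in> K \<Longrightarrow> norm (L x q) \<le> C * norm q"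
proof -
  have "compact (K \<times> sphere (0 :: 'b) 1)"
    by (intro compact_Times K compact_sphere)
  then have "bounded ((\<lambda>(x, q). L x q) ` (K \<times> sphere 0 1))"
    by (intro compact_imp_bounded compact_continuous_image continuous_on_subset[OF cont]) auto
  then obtain C where C: "\<And>x q. x \<in> K \<Longrightarrow> norm q = 1 \<Longrightarrow> norm (L x q) \<le> C"
    by (force simp: bounded_iff)
  have "norm (L x q) \<le> C * norm q" if "x \<in> K" for x q
  proof (cases "q = 0")
    case False
    have "L x q = norm q *\<^sub>R L x (q /\<^sub>R norm q)"
      using False by (simp add: linear_scale[OF linear[OF that], symmetric])
    then show ?thesis
      using C[OF that, of "q /\<^sub>R norm q"] False by (simp add: mult.commute[of C] mult_left_mono)
  qed (simp add: linear_0[OF linear[OF that]])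
  then show thesis by (rule that)
qed

locale compactly_carried_measure = finite_measure M for M :: "'a::euclidean_space measure" +
  fixes K :: "'a set"
  assumes compact_carrier: "compact K"
    and sets_eq_borel [measurable_cong]: "sets M = sets borel"
    and AE_in_carrier: "AE x in M. x \<in> K"
begin

lemma integrable_continuous:
  fixes f :: "'a \<Rightarrow> 'b::{banach, second_countable_topology}"
  assumes "continuous_on UNIV f"
  shows "integrable M f"
proof -
  have "bounded (f ` K)"
    by (intro compact_imp_bounded compact_continuous_image compact_carrier continuous_on_subset[OF assms]) simp
  then obtain C where C: "\<And>x. x \<in> K \<Longrightarrow> norm (f x) \<le> C"
    unfolding bounded_iff by blast
  have "AE x in M. norm (f x) \<le> C"
    using AE_in_carrier by eventually_elim (rule C)
  moreover have "f \<in> borel_measurable M"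
    using borel_measurable_continuous_onI[OF assms] by measurable
  ultimately show ?thesis
    by (rule integrable_const_bound)
qed

lemma integral_eq_0_if_0_on_carrier:
  fixes g :: "'a \<Rightarrow> 'b::{banach, second_countable_topology}"
  assumes "\<And>x. x \<in> K \<Longrightarrow> g x = 0"
  shows "integral\<^sup>L M g = 0"
proof (rule integral_eq_zero_AE)
  show "AE x in M. g x = 0"
    using AE_in_carrier by eventually_elim (rule assms)
qed

lemma integrable_linear_family:
  fixes L :: "'a \<Rightarrow> 'b::euclidean_space \<Rightarrow> 'c::{banach, second_countable_topology}"
  assumes cont: "continuous_on UNIV (\<lambda>(x, q). L x q)" and linear: "\<And>x. linear (L x)"
    and f: "integrable M f"
  shows "integrable M (\<lambda>x. L x (f x))"
proof -
  obtain C where C: "\<And>x q. x \<in> K \<Longrightarrow> norm (L x q) \<le> C * norm q"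
    using linear_family_bound[OF compact_carrier continuous_on_subset[OF cont] linear] by blast
  show ?thesis
  proof (rule Bochner_Integration.integrable_bound)
    show "integrable M (\<lambda>x. C * norm (f x))"
      using f by simp
    have "(\<lambda>(x, q). L x q) \<in> borel_measurable (borel \<Otimes>\<^sub>M borel)"
      using borel_measurable_continuous_onI[OF cont] by (simp add: borel_prod)
    then show "(\<lambda>x. L x (f x)) \<in> borel_measurable M"
      using f by measurable
    show "AE x in M. norm (L x (f x)) \<le> norm (C * norm (f x))"
      using AE_in_carrier by eventually_elim (metis C real_norm_def abs_ge_self order_trans)
  qed
qed

end

text \<open>Unbounded test functions are admitted because the measures considered here are carried by a fixed
  compact set.\<close>

definition weakly_converges :: "(nat \<Rightarrow> 'a::topological_space measure) \<Rightarrow> 'a measure \<Rightarrow> bool" where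
  "weakly_converges \<mu> M \<longleftrightarrow>
     (\<forall>g :: 'a \<Rightarrow> real. continuous_on UNIV g \<longrightarrow> (\<lambda>n. integral\<^sup>L (\<mu> n) g) \<longlonglongrightarrow> integral\<^sup>L M g)"

lemma weakly_converges_distr:
  assumes conv: "weakly_converges \<mu> M" and f: "continuous_on UNIV f"
    and sets [measurable_cong]: "\<And>n. sets (\<mu> n) = sets borel" "sets M = sets borel"
  shows "weakly_converges (\<lambda>n. distr (\<mu> n) borel f) (distr M borel f)"
  unfolding weakly_converges_def
proof (intro allI impI)
  fix g :: "'b \<Rightarrow> real" assume g: "continuous_on UNIV g"
  note [measurable] = borel_measurable_continuous_onI[OF f] borel_measurable_continuous_onI[OF g]
  have "continuous_on UNIV (\<lambda>x. g (f x))"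
    by (rule continuous_on_compose2[OF g f]) simp
  then have "(\<lambda>n. \<integral>x. g (f x) \<partial>\<mu> n) \<longlonglongrightarrow> (\<integral>x. g (f x) \<partial>M)"
    using conv by (simp add: weakly_converges_def)
  then show "(\<lambda>n. integral\<^sup>L (distr (\<mu> n) borel f) g) \<longlonglongrightarrow> integral\<^sup>L (distr M borel f) g"
    by (simp add: integral_distr)
qed

lemma weak_limit_compactly_carried:
  assumes \<mu>: "\<And>n. compactly_carried_measure (\<mu> n) K" and prob: "\<And>n. prob_space (\<mu> n)"
    and conv: "weakly_converges \<mu> L" and L: "prob_space L" "sets L = sets borel"
  shows "compactly_carried_measure L K"
proof -
  interpret \<mu>: compactly_carried_measure "\<mu> n" K for n by (rule \<mu>)
  interpret L: prob_space L by (rule L)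
  note [measurable_cong] = L(2)
  define h where "h x = min 1 (infdist x K)" for x
  have h_nonneg: "0 \<le> h x" for x
    by (simp add: h_def infdist_nonneg)
  have h_cont: "continuous_on UNIV h"
    unfolding h_def by (intro continuous_intros)
  have "integral\<^sup>L (\<mu> n) h = 0" for n
    by (rule \<mu>.integral_eq_0_if_0_on_carrier) (simp add: h_def)
  then have "integral\<^sup>L L h = 0"
    using conv[unfolded weakly_converges_def, rule_format, OF h_cont] by (simp add: LIMSEQ_const_iff)
  moreover have "integrable L h"
    by (rule L.integrable_const_bound[where B = 1])
      (use borel_measurable_continuous_onI[OF h_cont] h_nonneg in \<open>auto simp: h_def\<close>)
  ultimately have h_AE: "AE x in L. h x = 0"
    using h_nonneg by (simp add: integral_nonneg_eq_0_iff_AE)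
  have "K \<noteq> {}"
    using \<mu>.AE_in_carrier[of 0] prob_space.AE_False[OF prob] by auto
  have "AE x in L. x \<in> K"
    using h_AE
  proof eventually_elim
    case (elim x)
    then have "infdist x K = 0"
      by (simp add: h_def min_def split: if_splits)
    then show ?case
      using in_closed_iff_infdist_zero[OF compact_imp_closed[OF \<mu>.compact_carrier] \<open>K \<noteq> {}\<close>] by blast
  qed
  then show ?thesis
    by unfold_locales (auto simp: L \<mu>.compact_carrier)
qed

lemma tight_if_carried_by_unit_interval:
  assumes "\<And>n. prob_space (\<nu> n)" "\<And>n. compactly_carried_measure (\<nu> n) {0..1}"
  shows "tight \<nu>"
proof -
  interpret \<nu>: compactly_carried_measure "\<nu> n" "{0..1}" for n by (rule assms)
  interpret \<nu>: prob_space "\<nu> n" for n by (rule assms)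
  have "measure (\<nu> n) {-1<..1} = 1" for n
  proof -
    have "AE x in \<nu> n. x \<in> {-1<..1}"
      using \<nu>.AE_in_carrier[of n] by eventually_elim auto
    then show ?thesis
      using \<nu>.prob_eq_1[of "{-1<..1}" n] by (simp add: \<nu>.sets_eq_borel)
  qed
  moreover have "real_distribution (\<nu> n)" for n
    by unfold_locales (simp_all add: \<nu>.sets_eq_borel)
  ultimately show ?thesis
    unfolding tight_def by (intro conjI allI impI exI[of _ "-1::real"] exI[of _ "1::real"]) auto
qed

text \<open>Convergence in distribution tests with bounded functions only; pushing the limit forward under a
  retraction onto the interval makes every continuous test function bounded.\<close>

lemma weakly_converges_distr_retraction:
  assumes \<nu>: "\<And>n. compactly_carried_measure (\<nu> n) {0..1}" "\<And>n. real_distribution (\<nu> n)"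
    and M: "real_distribution M" and conv: "weak_conv_m \<nu> M"
  shows "weakly_converges \<nu> (distr M borel (\<lambda>t. max 0 (min 1 t)))"
  unfolding weakly_converges_def
proof (intro allI impI)
  fix g :: "real \<Rightarrow> real" assume g: "continuous_on UNIV g"
  interpret \<nu>: compactly_carried_measure "\<nu> n" "{0..1}" for n by (rule \<nu>)
  interpret M: real_distribution M by (rule M)
  define h where "h t = g (max 0 (min 1 t))" for t
  have h: "continuous_on UNIV h"
    unfolding h_def by (rule continuous_on_compose2[OF g]) (intro continuous_intros subset_UNIV)+
  note [measurable] = borel_measurable_continuous_onI[OF g] borel_measurable_continuous_onI[OF h]
  have "bounded (g ` {0..1})"
    by (intro compact_imp_bounded compact_continuous_image continuous_on_subset[OF g]) auto
  then obtain B where "\<And>y. y \<in> g ` {0..1} \<Longrightarrow> norm y \<le> B"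
    by (auto simp: bounded_iff)
  then have B: "norm (h t) \<le> B" for t
    by (simp add: h_def)
  have "(\<lambda>n. integral\<^sup>L (\<nu> n) h) \<longlonglongrightarrow> integral\<^sup>L M h"
    using h by (intro weak_conv_imp_integral_bdd_continuous_conv[OF \<nu>(2) M conv _ B])
      (simp add: continuous_on_eq_continuous_at)
  moreover have "integral\<^sup>L (\<nu> n) h = integral\<^sup>L (\<nu> n) g" for n
  proof (rule integral_cong_AE)
    show "AE t in \<nu> n. h t = g t"
      using \<nu>.AE_in_carrier[of n] by eventually_elim (simp add: h_def)
  qed simp_all
  ultimately show "(\<lambda>n. integral\<^sup>L (\<nu> n) g) \<longlonglongrightarrow> integral\<^sup>L (distr M borel (\<lambda>t. max 0 (min 1 t))) g"
    by (simp add: h_def[abs_def] integral_distr)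
qed

lemma weak_compactness_unit_interval:
  fixes \<nu> :: "nat \<Rightarrow> real measure"
  assumes \<nu>: "\<And>n. compactly_carried_measure (\<nu> n) {0..1}" "\<And>n. prob_space (\<nu> n)"
  obtains r M where "strict_mono (r :: nat \<Rightarrow> nat)" "prob_space M" "sets M = sets borel"
    "weakly_converges (\<nu> \<circ> r) M"
proof -
  have tight: "tight \<nu>"
    using \<nu> by (intro tight_if_carried_by_unit_interval)
  then obtain r M where r: "strict_mono (r :: nat \<Rightarrow> nat)" and M: "real_distribution M"
    and conv: "weak_conv_m (\<nu> \<circ> r) M"
    using tight_imp_convergent_subsubsequence[of \<nu> id] by (auto simp: strict_mono_id)
  interpret M: real_distribution M by (rule M)
  show thesis
  proof (rule that[OF r])
    show "weakly_converges (\<nu> \<circ> r) (distr M borel (\<lambda>t. max 0 (min 1 t)))"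
      using \<nu>(1) tight by (intro weakly_converges_distr_retraction M conv) (simp_all add: tight_def)
    show "prob_space (distr M borel (\<lambda>t. max 0 (min 1 t)))"
      by (rule M.prob_space_distr) simp
  qed simp
qed

lemma (in compactly_carried_measure) distr_distr_inverse_on_carrier:
  assumes [measurable]: "\<sigma> \<in> borel_measurable borel" "f \<in> borel_measurable borel"
    and inverse: "\<And>x. x \<in> K \<Longrightarrow> f (\<sigma> x) = x"
  shows "distr (distr M borel \<sigma>) borel f = M"
proof -
  have "distr (distr M borel \<sigma>) borel f = distr M borel (\<lambda>x. f (\<sigma> x))"
    by (simp add: distr_distr comp_def)
  also have "\<dots> = distr M borel (\<lambda>x. x)"
  proof (rule distr_cong_AE)
    show "AE x in M. f (\<sigma> x) = x"
      using AE_in_carrier by eventually_elim (rule inverse)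
  qed simp_all
  also have "\<dots> = M"
    by (simp add: distr_id2 sets_eq_borel)
  finally show ?thesis .
qed

lemma weak_compactness:
  fixes \<mu> :: "nat \<Rightarrow> 'a::euclidean_space measure"
  assumes \<mu>: "\<And>n. compactly_carried_measure (\<mu> n) K" and prob: "\<And>n. prob_space (\<mu> n)"
  obtains r L where "strict_mono (r :: nat \<Rightarrow> nat)" "compactly_carried_measure L K" "prob_space L"
    "weakly_converges (\<mu> \<circ> r) L"
proof -
  interpret \<mu>: compactly_carried_measure "\<mu> n" K for n by (rule \<mu>)
  obtain f :: "real \<Rightarrow> 'a" and \<sigma> where f: "continuous_on UNIV f"
    and [measurable]: "\<sigma> \<in> borel_measurable borel" and \<sigma>: "range \<sigma> \<subseteq> {0..1}"
    and f_\<sigma>: "\<And>x. x \<in> K \<Longrightarrow> f (\<sigma> x) = x"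
    using continuous_curve_with_measurable_section[OF compact_imp_bounded[OF \<mu>.compact_carrier]] by blast
  note [measurable] = borel_measurable_continuous_onI[OF f]
  define \<nu> where "\<nu> n = distr (\<mu> n) borel \<sigma>" for n
  have \<nu>_prob: "prob_space (\<nu> n)" for n
    unfolding \<nu>_def by (intro prob_space.prob_space_distr prob) measurable
  have \<nu>_carried: "compactly_carried_measure (\<nu> n) {0..1}" for n
  proof -
    have "AE t in \<nu> n. t \<in> {0..1}"
      unfolding \<nu>_def using \<sigma> by (subst AE_distr_iff) (auto simp: image_subset_iff)
    then show ?thesis
      unfolding compactly_carried_measure_def compactly_carried_measure_axioms_def
      using prob_space.finite_measure[OF \<nu>_prob] by (simp add: \<nu>_def del: AE_conj_iff)
  qed
  obtain r M where r: "strict_mono (r :: nat \<Rightarrow> nat)" and M: "prob_space M" "sets M = sets borel"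
    and conv: "weakly_converges (\<nu> \<circ> r) M"
    by (rule weak_compactness_unit_interval[OF \<nu>_carried \<nu>_prob])
  note [measurable_cong] = M(2)
  have "distr (\<nu> n) borel f = \<mu> n" for n
    unfolding \<nu>_def by (rule \<mu>.distr_distr_inverse_on_carrier) (simp_all add: f_\<sigma>)
  then have limit: "weakly_converges (\<mu> \<circ> r) (distr M borel f)"
    using weakly_converges_distr[OF conv f] M by (simp add: \<nu>_def comp_def)
  have L_prob: "prob_space (distr M borel f)"
    by (intro prob_space.prob_space_distr M) measurable
  moreover have "compactly_carried_measure (distr M borel f) K"
    by (rule weak_limit_compactly_carried[OF _ _ limit L_prob]) (simp_all add: \<mu> prob)
  ultimately show thesis
    using limit by (intro that[OF r])
qed

section \<open>Continuously differentiable functions\<close>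

lemma Ck_on_1D:
  assumes "Ck_on 1 W f"
  shows "x \<in> W \<Longrightarrow> (f has_derivative frechet_derivative f (at x)) (at x)"
    and "continuous_on W (\<lambda>x. frechet_derivative f (at x) v)"
    and "continuous_on W f"
proof -
  show derivative: "(f has_derivative frechet_derivative f (at x)) (at x)" if "x \<in> W" for x
    using assms that by (simp add: frechet_derivative_works[symmetric])
  show "continuous_on W (\<lambda>x. frechet_derivative f (at x) v)"
    using assms by simp
  show "continuous_on W f"
    by (meson continuous_at_imp_continuous_on derivative has_derivative_continuous)
qed

lemma Ck_on_1I:
  assumes derivative: "\<And>x. x \<in> W \<Longrightarrow> (f has_derivative f' x) (at x)"
    and cont: "\<And>v. continuous_on W (\<lambda>x. f' x v)"
  shows "Ck_on 1 W f"
proof -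
  have "f' x = frechet_derivative f (at x)" if "x \<in> W" for x
    using derivative[OF that] by (rule frechet_derivative_at)
  then have "continuous_on W (\<lambda>x. frechet_derivative f (at x) v)" for v
    using cont[of v] by (simp cong: continuous_on_cong)
  then show ?thesis
    using derivative by (auto simp: differentiable_def)
qed

lemma continuous_on_frechet_derivative:
  assumes f: "Ck_on 1 W f" and g: "continuous_on S g" "g ` S \<subseteq> W" and h: "continuous_on S h"
  shows "continuous_on S (\<lambda>x. frechet_derivative f (at (g x)) (h x))"
proof -
  have "frechet_derivative f (at y) v = (\<Sum>b\<in>Basis. (v \<bullet> b) *\<^sub>R frechet_derivative f (at y) b)"
    if "y \<in> W" for y v
  proof -
    have "linear (frechet_derivative f (at y))"
      using Ck_on_1D(1)[OF f that] by (rule has_derivative_linear)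
    from linear_sum[OF this, of "\<lambda>b. (v \<bullet> b) *\<^sub>R b" Basis] linear_scale[OF this] show ?thesis
      by (simp add: euclidean_representation)
  qed
  moreover have "continuous_on S (\<lambda>x. \<Sum>b\<in>Basis. (h x \<bullet> b) *\<^sub>R frechet_derivative f (at (g x)) b)"
    by (intro continuous_intros h continuous_on_compose2[OF Ck_on_1D(2)[OF f] g])
  ultimately show ?thesis
    using g(2) by (simp add: image_subset_iff cong: continuous_on_cong)
qed

lemma Ck_on_1_bounded_linear:
  assumes "bounded_linear f"
  shows "Ck_on 1 W f"
  by (rule Ck_on_1I[where f' = "\<lambda>_. f"]) (auto intro: bounded_linear_imp_has_derivative assms)

lemma Ck_on_1_const: "Ck_on 1 W (\<lambda>x. c)"
  by (rule Ck_on_1I[where f' = "\<lambda>_ _. 0"]) auto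

lemma Ck_on_1_add:
  assumes "Ck_on 1 W f" "Ck_on 1 W g"
  shows "Ck_on 1 W (\<lambda>x. f x + g x)"
  by (rule Ck_on_1I[where f' = "\<lambda>x v. frechet_derivative f (at x) v + frechet_derivative g (at x) v"])
    (intro has_derivative_add continuous_on_add assms[THEN Ck_on_1D(1)] assms[THEN Ck_on_1D(2)]; assumption)+

lemma Ck_on_1_bilinear:
  assumes B: "bounded_bilinear B" and C1: "Ck_on 1 W f" "Ck_on 1 W g"
  shows "Ck_on 1 W (\<lambda>x. B (f x) (g x))"
proof (rule Ck_on_1I)
  interpret bounded_bilinear B by (rule B)
  show "((\<lambda>x. B (f x) (g x)) has_derivative
      (\<lambda>v. B (f x) (frechet_derivative g (at x) v) + B (frechet_derivative f (at x) v) (g x))) (at x)"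
    if "x \<in> W" for x
    by (intro FDERIV Ck_on_1D(1)[OF _ that] C1)
  show "continuous_on W (\<lambda>x. B (f x) (frechet_derivative g (at x) v) + B (frechet_derivative f (at x) v) (g x))" for v
    by (intro continuous_on continuous_intros C1[THEN Ck_on_1D(3)] C1[THEN Ck_on_1D(2)])
qed

lemmas Ck_on_1_mult = Ck_on_1_bilinear[OF bounded_bilinear_mult]

lemma Ck_on_1_prod:
  fixes f :: "'i \<Rightarrow> 'a::euclidean_space \<Rightarrow> real"
  assumes "\<And>i. i \<in> I \<Longrightarrow> Ck_on 1 W (f i)"
  shows "Ck_on 1 W (\<lambda>x. \<Prod>i\<in>I. f i x)"
  using assms
proof (induction I rule: infinite_finite_induct)
  case (insert i I)
  then show ?case
    using Ck_on_1_mult[of W "f i" "\<lambda>x. \<Prod>i\<in>I. f i x"] by (simp del: Ck_on.simps One_nat_def)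
qed (simp_all add: Ck_on_1_const del: Ck_on.simps One_nat_def)

lemma Ck_on_1_compose:
  assumes f: "Ck_on 1 W f" and g: "Ck_on 1 V g" and sub: "f ` W \<subseteq> V"
  shows "Ck_on 1 W (\<lambda>x. g (f x))"
proof (rule Ck_on_1I)
  show "((\<lambda>x. g (f x)) has_derivative
      (\<lambda>v. frechet_derivative g (at (f x)) (frechet_derivative f (at x) v))) (at x)" if "x \<in> W" for x
    using sub that by (intro has_derivative_compose[OF Ck_on_1D(1)[OF f]] Ck_on_1D(1)[OF g]) auto
  show "continuous_on W (\<lambda>x. frechet_derivative g (at (f x)) (frechet_derivative f (at x) v))" for v
    by (rule continuous_on_frechet_derivative[OF g Ck_on_1D(3)[OF f] sub Ck_on_1D(2)[OF f]])
qed

lemma Ck_on_1_real: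
  fixes h :: "real \<Rightarrow> real"
  assumes "\<And>t. t \<in> W \<Longrightarrow> (h has_real_derivative h' t) (at t)" "continuous_on W h'"
  shows "Ck_on 1 W h"
  using assms
  by (intro Ck_on_1I[where f' = "\<lambda>t. (*) (h' t)"])
    (auto simp: has_field_derivative_def intro!: continuous_intros)

lemma Ck_on_1_inverse: "Ck_on 1 (- {0}) (inverse :: real \<Rightarrow> real)"
  by (rule Ck_on_1_real[where h' = "\<lambda>t. - (inverse t ^ 2)"])
    (auto intro!: derivative_eq_intros continuous_intros simp: numeral_2_eq_2)

lemma has_real_derivative_max_zero_squared:
  "((\<lambda>t. (max 0 t)\<^sup>2) has_real_derivative 2 * max 0 t) (at t)"
proof -
  consider (positive) "t > 0" | (negative) "t < 0" | (zero) "t = 0" by linarith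
  then show ?thesis
  proof cases
    case positive
    have "((\<lambda>t. t\<^sup>2) has_real_derivative 2 * t) (at t)"
      by (auto intro!: derivative_eq_intros)
    then have "((\<lambda>t. (max 0 t)\<^sup>2) has_real_derivative 2 * t) (at t)"
      by (rule has_field_derivative_transform_within_open[of _ _ _ "{0<..}"]) (use positive in auto)
    then show ?thesis using positive by simp
  next
    case negative
    have "((\<lambda>_. 0) has_real_derivative 0) (at t)"
      by simp
    then have "((\<lambda>t. (max 0 t)\<^sup>2) has_real_derivative 0) (at t)"
      by (rule has_field_derivative_transform_within_open[of _ _ _ "{..<0}"]) (use negative in auto)
    then show ?thesis using negative by simp
  next
    case zero
    have "((\<lambda>h::real. (max 0 h)\<^sup>2 / h) \<longlongrightarrow> 0) (at 0)"
    proof (rule Lim_null_comparison)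
      show "\<forall>\<^sub>F h in at 0. norm ((max 0 h)\<^sup>2 / h) \<le> \<bar>h::real\<bar>"
        by (auto simp: max_def power2_eq_square)
      show "((\<lambda>h::real. \<bar>h\<bar>) \<longlongrightarrow> 0) (at 0)"
        by (rule tendsto_rabs_zero) (rule tendsto_ident_at)
    qed
    then show ?thesis using zero by (simp add: has_field_derivative_iff)
  qed
qed

lemma Ck_on_1_max_zero_squared: "Ck_on 1 UNIV (\<lambda>t::real. (max 0 t)\<^sup>2)"
  by (rule Ck_on_1_real[OF has_real_derivative_max_zero_squared]) (intro continuous_intros)

lemma box_eq_support_of_C1:
  fixes a b :: "'a::euclidean_space"
  obtains w :: "'a \<Rightarrow> real"
  where "Ck_on 1 UNIV w" "\<And>x. 0 \<le> w x" "{x. w x \<noteq> 0} = box a b"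
proof
  let ?w = "\<lambda>x. \<Prod>i\<in>Basis. (max 0 (x \<bullet> i + - (a \<bullet> i)))\<^sup>2 * (max 0 (x \<bullet> - i + b \<bullet> i))\<^sup>2"
  show "Ck_on 1 UNIV ?w"
    by (intro Ck_on_1_prod Ck_on_1_mult Ck_on_1_compose[OF _ Ck_on_1_max_zero_squared] Ck_on_1_add
        Ck_on_1_const Ck_on_1_bounded_linear bounded_linear_inner_left subset_UNIV)
  show "0 \<le> ?w x" for x
    by (intro prod_nonneg) auto
  show "{x. ?w x \<noteq> 0} = box a b"
    by (auto simp: box_def max_def not_le)
qed

lemma C1_approximation_of_support_indicator:
  fixes w :: "'a::euclidean_space \<Rightarrow> real"
  assumes w: "Ck_on 1 UNIV w" and nonneg: "\<And>x. 0 \<le> w x"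
  defines "f \<equiv> \<lambda>n x. w x * inverse (w x + 1 / real (Suc n))"
  shows "Ck_on 1 UNIV (f n)" and "{x. f n x \<noteq> 0} = {x. w x \<noteq> 0}" and "\<bar>f n x\<bar> \<le> 1"
    and "(\<lambda>n. f n x) \<longlonglongrightarrow> indicator {x. w x \<noteq> 0} x"
proof -
  have pos: "w x + 1 / real (Suc n) > 0" for x n
    using nonneg by (intro add_nonneg_pos) auto
  have nonzero: "w x + 1 / real (Suc n) \<noteq> 0" for x n
    using pos[of x n] by simp
  show "Ck_on 1 UNIV (f n)"
    unfolding f_def
    by (intro Ck_on_1_mult w Ck_on_1_compose[OF _ Ck_on_1_inverse] Ck_on_1_add Ck_on_1_const)
      (use nonzero in auto)
  show "{x. f n x \<noteq> 0} = {x. w x \<noteq> 0}"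
    using nonzero by (auto simp: f_def)
  show "\<bar>f n x\<bar> \<le> 1"
    using nonneg[of x] pos[of x n] by (simp add: f_def field_simps abs_mult)
  show "(\<lambda>n. f n x) \<longlonglongrightarrow> indicator {x. w x \<noteq> 0} x"
  proof (cases "w x = 0")
    case False
    then have "(\<lambda>n. f n x) \<longlonglongrightarrow> w x * inverse (w x + 0)"
      unfolding f_def using LIMSEQ_inverse_real_of_nat
      by (intro tendsto_intros) (auto simp: inverse_eq_divide)
    then show ?thesis
      using False by simp
  qed (simp add: f_def)
qed

lemma nn_integral_eq_uminus_if_integral_zero:
  fixes h :: "'a \<Rightarrow> real"
  assumes h: "integrable M h" and zero: "integral\<^sup>L M h = 0"
  shows "(\<integral>\<^sup>+x. ennreal (h x) \<partial>M) = (\<integral>\<^sup>+x. ennreal (- h x) \<partial>M)"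
proof -
  have "(\<integral>\<^sup>+x. ennreal (h x) \<partial>M) < top" "(\<integral>\<^sup>+x. ennreal (- h x) \<partial>M) < top"
    using h by (auto simp: real_integrable_def less_top)
  moreover have "enn2real (\<integral>\<^sup>+x. ennreal (h x) \<partial>M) = enn2real (\<integral>\<^sup>+x. ennreal (- h x) \<partial>M)"
    using zero by (simp add: real_lebesgue_integral_def[OF h])
  ultimately show ?thesis
    by (metis ennreal_enn2real)
qed

text \<open>The positive and negative parts of \<open>g M\<close> agree on boxes, hence coincide.\<close>

lemma AE_zero_if_integral_box_zero:
  fixes g :: "'a::euclidean_space \<Rightarrow> real"
  assumes sets [measurable_cong]: "sets M = sets borel" and g: "integrable M g"
    and zero: "\<And>a b. (\<integral>x. indicator (box a b) x * g x \<partial>M) = 0"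
  shows "AE x in M. g x = 0"
proof -
  define pos where "pos = density M (\<lambda>x. ennreal (g x))"
  define neg where "neg = density M (\<lambda>x. ennreal (- g x))"
  have [measurable]: "g \<in> borel_measurable M"
    using g by simp
  have box_integrable: "integrable M (\<lambda>x. indicator (box a b) x * g x)" for a b
    using integrable_real_mult_indicator[OF _ g, of "box a b"] by (simp add: sets mult.commute)
  have pos_box: "emeasure pos (box a b) = (\<integral>\<^sup>+x. ennreal (indicator (box a b) x * g x) \<partial>M)" for a b
    unfolding pos_def by (auto simp: emeasure_density sets intro!: nn_integral_cong split: split_indicator)
  have neg_box: "emeasure neg (box a b) = (\<integral>\<^sup>+x. ennreal (- (indicator (box a b) x * g x)) \<partial>M)" for a b
    unfolding neg_def by (auto simp: emeasure_density sets intro!: nn_integral_cong split: split_indicator)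
  have "pos = neg"
  proof (rule measure_eqI_generator_eq[where E = "range (\<lambda>(a, b). box a b)" and \<Omega> = UNIV
        and A = "\<lambda>n. box (- (real n *\<^sub>R One)) (real n *\<^sub>R One)"])
    show "Int_stable (range (\<lambda>(a, b). box a b :: 'a set))"
      by (auto simp: Int_stable_def box_Int_box)
    show "sets pos = sigma_sets UNIV (range (\<lambda>(a, b). box a b))"
      "sets neg = sigma_sets UNIV (range (\<lambda>(a, b). box a b))"
      by (simp_all add: pos_def neg_def sets borel_eq_box)
    show "emeasure pos X = emeasure neg X" if "X \<in> range (\<lambda>(a, b). box a b)" for X
      using that nn_integral_eq_uminus_if_integral_zero[OF box_integrable zero]
      by (auto simp: pos_box neg_box)
    show "emeasure pos (box (- (real n *\<^sub>R One)) (real n *\<^sub>R One)) \<noteq> \<infinity>" for n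
      using box_integrable unfolding pos_box real_integrable_def by blast
  qed (auto simp: UN_box_eq_UNIV)
  moreover have "(\<integral>\<^sup>+x. ennreal (g x) \<partial>M) \<noteq> \<infinity>"
    using g by (simp add: real_integrable_def)
  ultimately have "AE x in M. ennreal (g x) = ennreal (- g x)"
    unfolding pos_def neg_def by (subst (asm) finite_density_unique) auto
  then show ?thesis
  proof eventually_elim
    case (elim x)
    then show ?case
      by (cases "g x \<ge> 0") (auto simp: ennreal_neg ennreal_eq_0_iff dest: sym)
  qed
qed

lemma AE_zero_if_integral_C1_zero:
  fixes g :: "'a::euclidean_space \<Rightarrow> real"
  assumes sets [measurable_cong]: "sets M = sets borel" and g: "integrable M g"
    and zero: "\<And>\<psi>. Ck_on 1 UNIV \<psi> \<Longrightarrow> compact (closure {x. \<psi> x \<noteq> 0}) \<Longrightarrow> (\<integral>x. \<psi> x * g x \<partial>M) = 0"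
  shows "AE x in M. g x = 0"
proof (rule AE_zero_if_integral_box_zero[OF sets g])
  fix a b :: 'a
  obtain w :: "'a \<Rightarrow> real" where w: "Ck_on 1 UNIV w" "\<And>x. 0 \<le> w x" and support: "{x. w x \<noteq> 0} = box a b"
    using box_eq_support_of_C1[of a b] by metis
  define f where "f n x = w x * inverse (w x + 1 / real (Suc n))" for n x
  note f = C1_approximation_of_support_indicator[OF w, folded f_def, unfolded support]
  have [measurable]: "g \<in> borel_measurable M" "f n \<in> borel_measurable M" for n
    using g borel_measurable_continuous_onI[OF Ck_on_1D(3)[OF f(1)]] by simp_all
  have "(\<lambda>n. \<integral>x. f n x * g x \<partial>M) \<longlonglongrightarrow> (\<integral>x. indicator (box a b) x * g x \<partial>M)"
  proof (rule integral_dominated_convergence[where w = "\<lambda>x. \<bar>g x\<bar>"])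
    show "AE x in M. (\<lambda>n. f n x * g x) \<longlonglongrightarrow> indicator (box a b) x * g x"
      by (intro always_eventually allI tendsto_intros f)
    show "AE x in M. norm (f n x * g x) \<le> \<bar>g x\<bar>" for n
      using f(3) by (auto simp: abs_mult intro!: mult_left_le_one_le)
  qed (use g in auto)
  moreover have "compact (closure (box a b))"
    by (simp add: bounded_box compact_closure)
  then have "(\<integral>x. f n x * g x \<partial>M) = 0" for n
    by (intro zero f) (simp add: f)
  ultimately show "(\<integral>x. indicator (box a b) x * g x \<partial>M) = 0"
    by (simp add: LIMSEQ_const_iff)
qed

section \<open>The Grassmann bundle\<close>

lemma bounded_bilinear_matrix_mult:
  "bounded_bilinear ((**) :: real^'n^'m \<Rightarrow> real^'p^'n \<Rightarrow> real^'p^'m)"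
  unfolding bilinear_conv_bounded_bilinear[symmetric] bilinear_def
  by (auto intro!: linearI
      simp: vec_eq_iff matrix_matrix_mult_def sum.distrib algebra_simps sum_distrib_left)

interpretation matrix_mult: bounded_bilinear "(**) :: real^'n^'m \<Rightarrow> real^'p^'n \<Rightarrow> real^'p^'m"
  by (rule bounded_bilinear_matrix_mult)

lemma bounded_linear_transpose: "bounded_linear (transpose :: real^'n^'m \<Rightarrow> real^'m^'n)"
  by (intro linear_conv_bounded_linear[THEN iffD1] linearI) (simp_all add: transpose_def vec_eq_iff)

lemmas transpose_add = linear_add[OF bounded_linear.linear[OF bounded_linear_transpose]]
lemmas transpose_zero = linear_0[OF bounded_linear.linear[OF bounded_linear_transpose]]
lemmas continuous_on_transpose = bounded_linear.continuous_on[OF bounded_linear_transpose]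

lemma norm_transpose: "norm (transpose A) = norm A" for A :: "real^'n^'m"
  unfolding norm_eq_sqrt_inner inner_vec_def transpose_def
  by (subst sum.swap) simp

lemma norm_matrix_vector_mult_le: "norm (A *v x) \<le> norm A * norm x" for A :: "real^'n^'m"
proof -
  have "norm (A *v x) \<le> L2_set (\<lambda>i. norm (A $ i) * norm x) UNIV"
    unfolding norm_vec_def[of "A *v x"] matrix_vector_mul_component real_norm_def
    by (intro L2_set_mono Cauchy_Schwarz_ineq2) auto
  also have "\<dots> = norm A * norm x"
    unfolding norm_vec_def[of A] by (rule L2_set_left_distrib[symmetric]) simp
  finally show ?thesis .
qed

lemma rank_le_if_close_idempotent:
  fixes A B :: "real^'s^'s"
  assumes A: "A ** A = A" and close: "norm (A - B) < 1"
  shows "rank A \<le> rank B"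
proof -
  have "inj_on ((*v) B) (range ((*v) A))"
  proof (rule inj_onI, rule ccontr)
    fix u v assume "u \<in> range ((*v) A)" "v \<in> range ((*v) A)" and B: "B *v u = B *v v" and "u \<noteq> v"
    then have "A *v u = u" "A *v v = v"
      using A by (auto simp: matrix_vector_mul_assoc)
    then have "norm (u - v) = norm ((A - B) *v (u - v))"
      using B by (simp add: matrix_vector_mult_diff_rdistrib matrix_vector_mult_diff_distrib)
    also have "\<dots> \<le> norm (A - B) * norm (u - v)"
      by (rule norm_matrix_vector_mult_le)
    also have "\<dots> < norm (u - v)"
      using close \<open>u \<noteq> v\<close> by simp
    finally show False by simp
  qed
  moreover have "span (range ((*v) A)) = range ((*v) A)"
    unfolding span_eq_iff by (rule linear_subspace_image[OF matrix_vector_mul_linear subspace_UNIV])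
  ultimately have "rank A = dim ((*v) B ` range ((*v) A))"
    unfolding rank_dim_range
    using dim_image_eq[OF matrix_vector_mul_linear, of B "range ((*v) A)"] by (simp only:)
  also have "\<dots> \<le> rank B"
    unfolding rank_dim_range by (rule dim_subset) auto
  finally show ?thesis .
qed

definition orth_projs :: "(real^'s^'s) set" where
  "orth_projs = {P. transpose P = P \<and> P ** P = P}"

lemma Grass_eq: "Grass m = {P \<in> orth_projs. rank P = m}"
  by (auto simp: Grass_def orth_projs_def)

lemma closed_orth_projs: "closed orth_projs"
  unfolding orth_projs_def
  by (intro closed_Collect_conj closed_Collect_eq continuous_on_transpose matrix_mult.continuous_on
      continuous_on_id)

lemma norm_row_orth_proj_le_1:
  assumes "P \<in> orth_projs"
  shows "norm (P $ i) \<le> 1"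
proof -
  have "P $ i $ i = (\<Sum>k\<in>UNIV. P $ i $ k * P $ k $ i)"
    using assms unfolding orth_projs_def matrix_matrix_mult_def vec_eq_iff by simp
  also have "\<dots> = (\<Sum>k\<in>UNIV. P $ i $ k * P $ i $ k)"
    using assms by (auto simp: orth_projs_def transpose_def vec_eq_iff intro!: sum.cong)
  also have "\<dots> = (norm (P $ i))\<^sup>2"
    by (simp add: power2_norm_eq_inner inner_vec_def)
  finally have "norm (P $ i) * norm (P $ i) \<le> norm (P $ i)"
    using component_le_norm_cart[of "P $ i" i] by (simp add: power2_eq_square)
  then show ?thesis
    using mult_le_cancel_right1[of "norm (P $ i)" "norm (P $ i)"] by (cases "P $ i = 0") auto
qed

lemma bounded_orth_projs: "bounded (orth_projs :: (real^'s^'s) set)"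
proof (rule boundedI)
  fix P :: "real^'s^'s" assume P: "P \<in> orth_projs"
  have "norm P \<le> (\<Sum>i\<in>UNIV. norm (P $ i))"
    unfolding norm_vec_def by (rule L2_set_le_sum) simp
  also have "\<dots> \<le> (\<Sum>i\<in>(UNIV :: 's set). 1)"
    by (intro sum_mono norm_row_orth_proj_le_1 P)
  finally show "norm P \<le> real CARD('s)"
    by simp
qed

lemma compact_Grass: "compact (Grass m :: (real^'s^'s) set)"
proof -
  have "closure (Grass m) \<subseteq> (Grass m :: (real^'s^'s) set)"
  proof
    fix P :: "real^'s^'s" assume P: "P \<in> closure (Grass m)"
    have proj: "P \<in> orth_projs"
      using P closure_minimal[OF _ closed_orth_projs, of "Grass m"] by (auto simp: Grass_eq)
    obtain P' where P': "P' \<in> Grass m" "norm (P' - P) < 1"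
      using P unfolding closure_approachable dist_norm using zero_less_one by blast
    then have "rank P = rank P'"
      using proj rank_le_if_close_idempotent[of P P'] rank_le_if_close_idempotent[of P' P]
      by (simp add: Grass_eq orth_projs_def norm_minus_commute)
    then show "P \<in> Grass m"
      using P' proj by (simp add: Grass_eq)
  qed
  then have "closed (Grass m :: (real^'s^'s) set)"
    by (simp add: closure_subset_eq)
  moreover have "bounded (Grass m :: (real^'s^'s) set)"
    using bounded_orth_projs by (rule bounded_subset) (auto simp: Grass_eq)
  ultimately show ?thesis
    by (simp add: compact_eq_bounded_closed)
qed

lemma is_orth_proj_range_subset_iff:
  assumes "is_orth_proj T Q"
  shows "range ((*v) P) \<subseteq> T \<longleftrightarrow> Q ** P = P"
proof
  assume "range ((*v) P) \<subseteq> T"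
  then have "Q *v (P *v v) = P *v v" for v
    using assms unfolding is_orth_proj_def
    by (metis (no_types, lifting) imageE matrix_vector_mul_assoc rangeI subsetD)
  then show "Q ** P = P"
    by (simp add: matrix_eq matrix_vector_mul_assoc)
next
  assume "Q ** P = P"
  then have "P *v v = Q *v (P *v v)" for v
    by (simp add: matrix_vector_mul_assoc)
  then show "range ((*v) P) \<subseteq> T"
    using assms unfolding is_orth_proj_def by (metis image_subsetI rangeI)
qed

lemma mem_Gm_iff:
  assumes "\<And>x. x \<in> N \<Longrightarrow> is_orth_proj (tangent_space Nbar x) (Q x)"
  shows "(x, P) \<in> Gm m Nbar N \<longleftrightarrow> x \<in> N \<and> P \<in> Grass m \<and> Q x ** P = P"
  using is_orth_proj_range_subset_iff[OF assms, of x P]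
  by (cases "x \<in> N") (simp_all add: Gm_def del: image_subset_iff)

lemma compact_Gm:
  assumes proj: "\<And>x. x \<in> N \<Longrightarrow> is_orth_proj (tangent_space Nbar x) (Q x)"
    and N: "compact N" and Q: "continuous_on N Q"
  shows "compact (Gm m Nbar N)"
proof -
  let ?K = "N \<times> (Grass m :: (real^'s^'s) set)"
  have K: "compact ?K"
    by (intro compact_Times N compact_Grass)
  have "continuous_on ?K (\<lambda>z. Q (fst z) ** snd z - snd z)"
    by (intro continuous_intros matrix_mult.continuous_on continuous_on_compose2[OF Q]) auto
  then have "closed {z \<in> ?K. Q (fst z) ** snd z - snd z = 0}"
    by (intro continuous_closed_preimage_constant compact_imp_closed K)
  moreover have "Gm m Nbar N = ?K \<inter> {z \<in> ?K. Q (fst z) ** snd z - snd z = 0}"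
    by (auto simp: mem_Gm_iff[OF proj])
  ultimately show ?thesis
    using compact_Int_closed[OF K] by simp
qed

text \<open>Differentiate \<open>Q\<^sup>2 = Q\<close> along a curve in \<open>Nbar\<close>.\<close>

lemma tangential_derivative_of_projection:
  fixes Q :: "real^'s \<Rightarrow> real^'s^'s"
  assumes idem: "\<And>y. y \<in> Nbar \<Longrightarrow> Q y ** Q y = Q y"
    and D: "(Q has_derivative D) (at x)" and v: "v \<in> tangent_space Nbar x"
  shows "D v = Q x ** D v + D v ** Q x"
proof -
  obtain \<gamma> e where e: "e > 0" and \<gamma>: "\<And>t. t \<in> {-e<..<e} \<Longrightarrow> \<gamma> t \<in> Nbar" "\<gamma> 0 = x"
    and \<gamma>': "(\<gamma> has_vector_derivative v) (at 0)"
    using v unfolding tangent_space_def by blast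
  have "((\<lambda>t. Q (\<gamma> t)) has_derivative (\<lambda>h. D (h *\<^sub>R v))) (at 0)"
    using has_derivative_compose[of \<gamma> "\<lambda>h. h *\<^sub>R v" 0 UNIV Q D] \<gamma>' D \<gamma>(2)
    by (simp add: has_vector_derivative_def)
  then have Q\<gamma>: "((\<lambda>t. Q (\<gamma> t)) has_vector_derivative D v) (at 0)"
    using linear_scale[OF has_derivative_linear[OF D]] by (simp add: has_vector_derivative_def)
  have "((\<lambda>t. Q (\<gamma> t) ** Q (\<gamma> t)) has_vector_derivative Q x ** D v + D v ** Q x) (at 0)"
    using matrix_mult.has_vector_derivative[OF Q\<gamma> Q\<gamma>] by (simp add: \<gamma>(2))
  then have "((\<lambda>t. Q (\<gamma> t)) has_vector_derivative Q x ** D v + D v ** Q x) (at 0)"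
    by (rule has_vector_derivative_transform_within_open[of _ _ _ "{-e<..<e}"]) (use e \<gamma> idem in auto)
  with Q\<gamma> show ?thesis
    by (rule vector_derivative_unique_at)
qed

lemma projected_derivation_eq_0:
  fixes P D Q :: "real^'s^'s"
  assumes D: "D = Q ** D + D ** Q" and QP: "Q ** P = P" and sym: "transpose Q = Q" "transpose P = P"
  shows "P ** D ** P = 0"
proof -
  have PQ: "P ** Q = P"
    using arg_cong[OF QP, of transpose] by (simp add: matrix_transpose_mul sym)
  have "P ** D ** P = P ** (Q ** D + D ** Q) ** P"
    using D by simp
  also have "\<dots> = (P ** Q) ** D ** P + P ** D ** (Q ** P)"
    by (simp add: matrix_mult.add_left matrix_mult.add_right matrix_mul_assoc)
  also have "\<dots> = P ** D ** P + P ** D ** P"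
    by (simp add: QP PQ)
  finally show ?thesis by simp
qed

section \<open>Generalized curvature\<close>

lemma linear_axis: "linear (axis i :: 'a::real_vector \<Rightarrow> 'a^'n)"
  by (rule linearI) (auto simp: axis_def vec_eq_iff)

lemma vec_eq_sum_axis: "x = (\<Sum>i\<in>UNIV. axis i (x $ i))" for x :: "'a::comm_monoid_add^'n"
  by (simp add: vec_eq_iff sum_component axis_def)

lemma linear_vec_expansion:
  fixes f :: "real^'n \<Rightarrow> 'a::real_vector"
  assumes "linear f"
  shows "f v = (\<Sum>j\<in>UNIV. v $ j *\<^sub>R f (axis j 1))"
proof -
  have "f v = (\<Sum>j\<in>UNIV. f (axis j (v $ j)))"
    by (subst vec_eq_sum_axis) (rule linear_sum[OF assms])
  also have "\<dots> = (\<Sum>j\<in>UNIV. v $ j *\<^sub>R f (axis j 1))"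
  proof (rule sum.cong[OF refl])
    show "f (axis j (v $ j)) = v $ j *\<^sub>R f (axis j 1)" for j
      using linear_scale[OF linear_compose[OF linear_axis[of j] assms], of "v $ j" 1] by simp
  qed
  finally show ?thesis .
qed

lemma linear_matrix_expansion:
  fixes f :: "real^'n^'m \<Rightarrow> 'a::real_vector"
  assumes "linear f"
  shows "f A = (\<Sum>j\<in>UNIV. \<Sum>k\<in>UNIV. A $ j $ k *\<^sub>R f (axis j (axis k 1)))"
proof -
  have "f A = (\<Sum>j\<in>UNIV. f (axis j (A $ j)))"
    by (subst vec_eq_sum_axis) (rule linear_sum[OF assms])
  also have "\<dots> = (\<Sum>j\<in>UNIV. \<Sum>k\<in>UNIV. A $ j $ k *\<^sub>R f (axis j (axis k 1)))"
  proof (rule sum.cong[OF refl])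
    show "f (axis j (A $ j)) = (\<Sum>k\<in>UNIV. A $ j $ k *\<^sub>R f (axis j (axis k 1)))" for j
      using linear_vec_expansion[OF linear_compose[OF linear_axis[of j] assms], of "A $ j"] by simp
  qed
  finally show ?thesis .
qed

lemma integrable_vec_iff:
  fixes f :: "'x \<Rightarrow> 'b::euclidean_space^'n"
  shows "integrable M f \<longleftrightarrow> (\<forall>i. integrable M (\<lambda>x. f x $ i))"
proof (intro iffI allI)
  show "integrable M (\<lambda>x. f x $ i)" if "integrable M f" for i
    using bounded_linear_vec_nth that by (rule integrable_bounded_linear)
  assume f: "\<forall>i. integrable M (\<lambda>x. f x $ i)"
  have "bounded_linear (axis i :: 'b \<Rightarrow> 'b^'n)" for i
    using linear_axis[where 'a = 'b] by (simp only: linear_conv_bounded_linear)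
  then have "integrable M (\<lambda>x. axis i (f x $ i))" for i
    using f integrable_bounded_linear[of "axis i" M "\<lambda>x. f x $ i"] by blast
  then have "integrable M (\<lambda>x. \<Sum>i\<in>UNIV. axis i (f x $ i))"
    by (rule Bochner_Integration.integrable_sum)
  then show "integrable M f"
    unfolding vec_eq_sum_axis[symmetric] .
qed

definition curvature_term ::
    "((real^'s) \<times> (real^'s^'s) \<Rightarrow> real) \<Rightarrow> 's \<Rightarrow> (real^'s) \<times> (real^'s^'s) \<Rightarrow> real^'s^'s^'s \<Rightarrow> real" where
  "curvature_term \<phi> i z q = frechet_derivative \<phi> (at z) (0, q $ i) + (\<Sum>j\<in>UNIV. q $ j $ i $ j) * \<phi> z"

definition first_variation ::
    "((real^'s) \<times> (real^'s^'s) \<Rightarrow> real^'s^'s^'s) \<Rightarrow> ((real^'s) \<times> (real^'s^'s) \<Rightarrow> real) \<Rightarrow>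
      's \<Rightarrow> (real^'s) \<times> (real^'s^'s) \<Rightarrow> real" where
  "first_variation B \<phi> i z = frechet_derivative \<phi> (at z) (snd z $ i, 0) + curvature_term \<phi> i z (B z)"

lemma C1c_imp_Ck_on_1: "C1c \<phi> \<Longrightarrow> Ck_on 1 UNIV \<phi>"
  by (simp only: C1c_def)

lemma linear_frechet_derivative_C1c: "C1c \<phi> \<Longrightarrow> linear (frechet_derivative \<phi> (at z))"
  by (rule has_derivative_linear[OF Ck_on_1D(1)[OF C1c_imp_Ck_on_1 UNIV_I]])

lemma gen_curvature_iff:
  "gen_curvature V B \<longleftrightarrow>
     integrable V B \<and> (\<forall>\<phi> i. C1c \<phi> \<longrightarrow> integral\<^sup>L V (first_variation B \<phi> i) = 0)"
proof -
  have "(\<Sum>j\<in>UNIV. snd z $ i $ j * Dx \<phi> j z) + (\<Sum>j\<in>UNIV. \<Sum>k\<in>UNIV. B z $ i $ j $ k * DP \<phi> j k z)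
      + (\<Sum>j\<in>UNIV. B z $ j $ i $ j) * \<phi> z = first_variation B \<phi> i z" if \<phi>: "C1c \<phi>" for \<phi> i z
  proof -
    have "linear (\<lambda>v::real^'s. (v, 0::real^'s^'s))" "linear (\<lambda>X::real^'s^'s. (0::real^'s, X))"
      by (auto intro!: linearI)
    note this[THEN linear_compose, OF linear_frechet_derivative_C1c[OF \<phi>, of z], unfolded o_def]
    from linear_vec_expansion[OF this(1), of "snd z $ i"] linear_matrix_expansion[OF this(2), of "B z $ i"]
    show ?thesis
      by (simp add: first_variation_def curvature_term_def Dx_def DP_def)
  qed
  then show ?thesis
    unfolding gen_curvature_def integrable_vec_iff by (simp cong: imp_cong)
qed

lemma linear_curvature_term:
  fixes i :: "'s::finite"
  assumes "C1c \<phi>"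
  shows "linear (curvature_term \<phi> i z)"
proof (rule linearI)
  let ?D = "frechet_derivative \<phi> (at z)"
  note linear = linear_frechet_derivative_C1c[OF assms, of z]
  fix p q :: "real^'s^'s^'s" and c :: real
  have "?D (0, (p + q) $ i) = ?D (0, p $ i) + ?D (0, q $ i)"
    using linear_add[OF linear, of "(0, p $ i)" "(0, q $ i)"] by simp
  then show "curvature_term \<phi> i z (p + q) = curvature_term \<phi> i z p + curvature_term \<phi> i z q"
    by (simp add: curvature_term_def sum.distrib algebra_simps)
  have "?D (0, (c *\<^sub>R q) $ i) = c * ?D (0, q $ i)"
    using linear_scale[OF linear, of c "(0, q $ i)"] by simp
  then show "curvature_term \<phi> i z (c *\<^sub>R q) = c *\<^sub>R curvature_term \<phi> i z q"
    by (simp add: curvature_term_def sum_distrib_left algebra_simps)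
qed

lemma continuous_on_curvature_term:
  assumes \<phi>: "C1c \<phi>" and cont: "continuous_on S f" "continuous_on S q"
  shows "continuous_on S (\<lambda>x. curvature_term \<phi> i (f x) (q x))"
  unfolding curvature_term_def using cont
  by (intro continuous_intros continuous_on_frechet_derivative[OF C1c_imp_Ck_on_1[OF \<phi>]]
      continuous_on_compose2[OF Ck_on_1D(3)[OF C1c_imp_Ck_on_1[OF \<phi>]]]) auto

lemma continuous_on_first_variation:
  assumes \<phi>: "C1c \<phi>" and B: "continuous_on S B"
  shows "continuous_on S (first_variation B \<phi> i)"
  unfolding first_variation_def[abs_def] using B
  by (intro continuous_intros continuous_on_curvature_term[OF \<phi>]
      continuous_on_frechet_derivative[OF C1c_imp_Ck_on_1[OF \<phi>]]) auto

lemma integrable_curvature_term: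
  assumes V: "compactly_carried_measure V K" and B: "integrable V B" and \<phi>: "C1c \<phi>"
  shows "integrable V (\<lambda>z. curvature_term \<phi> i z (B z))"
proof (rule compactly_carried_measure.integrable_linear_family[OF V _ linear_curvature_term[OF \<phi>] B])
  show "continuous_on UNIV (\<lambda>(z, q). curvature_term \<phi> i z q)"
    unfolding split_beta by (intro continuous_on_curvature_term[OF \<phi>] continuous_intros)
qed

lemma integrable_first_variation:
  assumes V: "compactly_carried_measure V K" and B: "integrable V B" and \<phi>: "C1c \<phi>"
  shows "integrable V (first_variation B \<phi> i)"
proof -
  have "continuous_on UNIV (\<lambda>z. frechet_derivative \<phi> (at z) (snd z $ i, 0))"
    by (intro continuous_on_frechet_derivative[OF C1c_imp_Ck_on_1[OF \<phi>]] continuous_intros subset_UNIV)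
  then show ?thesis
    unfolding first_variation_def[abs_def]
    by (intro Bochner_Integration.integrable_add integrable_curvature_term[OF V B \<phi>]
        compactly_carried_measure.integrable_continuous[OF V])
qed

lemma C1c_mult:
  assumes g: "Ck_on 1 UNIV g" and \<psi>: "C1c \<psi>"
  shows "C1c (\<lambda>z. g z * \<psi> z)"
proof -
  have "closure {z. g z * \<psi> z \<noteq> 0} \<subseteq> closure {z. \<psi> z \<noteq> 0}"
    by (rule closure_mono) auto
  moreover have "compact (closure {z. \<psi> z \<noteq> 0})"
    using \<psi> by (simp only: C1c_def)
  ultimately have "compact (closure {z. g z * \<psi> z \<noteq> 0})"
    by (meson closed_closure compact_Int_closed compact_imp_bounded bounded_subset compact_eq_bounded_closed)
  then show ?thesis
    using Ck_on_1_mult[OF g C1c_imp_Ck_on_1[OF \<psi>]] by (simp only: C1c_def)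
qed

text \<open>Test with \<open>h(P) \<psi>(x, P)\<close>: where \<open>h\<close> vanishes only its \<open>P\<close>-derivative survives.\<close>

lemma first_variation_constraint_times_test:
  assumes h: "Ck_on 1 UNIV h" and \<psi>: "C1c \<psi>" and zero: "h (snd z) = 0"
  shows "first_variation B (\<lambda>z. h (snd z) * \<psi> z) i z = \<psi> z * frechet_derivative h (at (snd z)) (B z $ i)"
proof -
  let ?h' = "frechet_derivative h (at (snd z))"
  have h': "(h has_derivative ?h') (at (snd z))"
    by (rule Ck_on_1D(1)[OF h]) simp
  have "((\<lambda>z. h (snd z)) has_derivative (\<lambda>v. ?h' (snd v))) (at z)"
    by (rule has_derivative_compose[OF has_derivative_snd[OF has_derivative_ident] h'])
  then have "((\<lambda>z. h (snd z) * \<psi> z) has_derivative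
      (\<lambda>v. h (snd z) * frechet_derivative \<psi> (at z) v + ?h' (snd v) * \<psi> z)) (at z)"
    by (rule has_derivative_mult) (rule Ck_on_1D(1)[OF C1c_imp_Ck_on_1[OF \<psi>] UNIV_I])
  then have "frechet_derivative (\<lambda>z. h (snd z) * \<psi> z) (at z) = (\<lambda>v. ?h' (snd v) * \<psi> z)"
    using zero by (simp add: frechet_derivative_at[symmetric])
  moreover have "?h' 0 = 0"
    using h'[THEN has_derivative_linear] by (rule linear_0)
  ultimately show ?thesis
    by (simp add: first_variation_def curvature_term_def zero)
qed

lemma curvature_tangent_to_real_constraint:
  fixes h :: "real^'s^'s \<Rightarrow> real"
  assumes V: "compactly_carried_measure V K" and B: "gen_curvature V B"
    and h: "Ck_on 1 UNIV h" and zero: "\<And>z. z \<in> K \<Longrightarrow> h (snd z) = 0"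
  shows "AE z in V. frechet_derivative h (at (snd z)) (B z $ i) = 0"
proof (rule AE_zero_if_integral_C1_zero)
  interpret compactly_carried_measure V K by (rule V)
  have B_integrable: "integrable V B"
    using B by (simp add: gen_curvature_iff)
  show "sets V = sets borel"
    by (rule sets_eq_borel)
  show h'_integrable: "integrable V (\<lambda>z. frechet_derivative h (at (snd z)) (B z $ i))"
  proof (rule integrable_linear_family[OF _ _ B_integrable])
    show "continuous_on UNIV (\<lambda>(z, q). frechet_derivative h (at (snd z)) (q $ i))"
      unfolding split_beta by (intro continuous_on_frechet_derivative[OF h] continuous_intros subset_UNIV)
    show "linear (\<lambda>q. frechet_derivative h (at (snd z)) (q $ i))" for z
      using linear_compose[OF bounded_linear.linear[OF bounded_linear_vec_nth]
          has_derivative_linear[OF Ck_on_1D(1)[OF h UNIV_I]]] by (simp add: o_def)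
  qed
  fix \<psi> :: "(real^'s) \<times> (real^'s^'s) \<Rightarrow> real"
  assume "Ck_on 1 UNIV \<psi>" "compact (closure {z. \<psi> z \<noteq> 0})"
  then have \<psi>: "C1c \<psi>"
    by (simp only: C1c_def)
  let ?\<phi> = "\<lambda>z. h (snd z) * \<psi> z"
  have \<phi>: "C1c ?\<phi>"
    by (intro C1c_mult \<psi> Ck_on_1_compose[OF Ck_on_1_bounded_linear[OF bounded_linear_snd] h] subset_UNIV)
  have "AE z in V. \<psi> z * frechet_derivative h (at (snd z)) (B z $ i) = first_variation B ?\<phi> i z"
    using AE_in_carrier
    by eventually_elim (simp add: first_variation_constraint_times_test[OF h \<psi>] zero)
  moreover have "\<psi> \<in> borel_measurable V"
    using borel_measurable_continuous_onI[OF Ck_on_1D(3)[OF C1c_imp_Ck_on_1[OF \<psi>]]] by measurable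
  ultimately have "(\<integral>z. \<psi> z * frechet_derivative h (at (snd z)) (B z $ i) \<partial>V) =
      integral\<^sup>L V (first_variation B ?\<phi> i)"
    using h'_integrable integrable_first_variation[OF V B_integrable \<phi>]
    by (intro integral_cong_AE) auto
  then show "(\<integral>z. \<psi> z * frechet_derivative h (at (snd z)) (B z $ i) \<partial>V) = 0"
    using B \<phi> by (simp add: gen_curvature_iff)
qed

lemma curvature_tangent_to_constraint:
  fixes h :: "real^'s^'s \<Rightarrow> 'b::euclidean_space"
  assumes V: "compactly_carried_measure V K" and B: "gen_curvature V B"
    and h: "\<And>P. (h has_derivative h' P) (at P)" "\<And>X. continuous_on UNIV (\<lambda>P. h' P X)"
    and zero: "\<And>z. z \<in> K \<Longrightarrow> h (snd z) = 0"
  shows "AE z in V. \<forall>i. h' (snd z) (B z $ i) = 0"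
proof -
  have "AE z in V. h' (snd z) (B z $ i) \<bullet> b = 0" for b i
  proof -
    have derivative: "((\<lambda>P. h P \<bullet> b) has_derivative (\<lambda>X. h' P X \<bullet> b)) (at P)" for P
      by (intro has_derivative_inner_left h)
    then have "Ck_on 1 UNIV (\<lambda>P. h P \<bullet> b)"
      using h(2) by (intro Ck_on_1I[where f' = "\<lambda>P X. h' P X \<bullet> b"] continuous_intros)
    from curvature_tangent_to_real_constraint[OF V B this, of i] show ?thesis
      by (simp add: zero frechet_derivative_at[OF derivative, symmetric])
  qed
  then have "AE z in V. \<forall>i. \<forall>b\<in>Basis. h' (snd z) (B z $ i) \<bullet> b = 0"
    by (simp add: AE_all_countable AE_ball_countable countable_finite)
  then show ?thesis
    by (simp add: euclidean_all_zero_iff)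
qed

lemma curvature_symmetric:
  assumes "compactly_carried_measure V K" "gen_curvature V B" and K: "snd ` K \<subseteq> orth_projs"
  shows "AE z in V. \<forall>i. transpose (B z $ i) = B z $ i"
proof -
  have "AE z in V. \<forall>i. transpose (B z $ i) - B z $ i = 0"
  proof (rule curvature_tangent_to_constraint[OF assms(1,2)])
    show "((\<lambda>P. transpose P - P) has_derivative (\<lambda>X. transpose X - X)) (at P)" for P :: "real^'s^'s"
      by (intro has_derivative_diff bounded_linear_imp_has_derivative bounded_linear_transpose has_derivative_ident)
    show "transpose (snd z) - snd z = 0" if "z \<in> K" for z
      using K that by (auto simp: orth_projs_def)
  qed (rule continuous_on_const)
  then show ?thesis by simp
qed

lemma curvature_derivation:
  assumes "compactly_carried_measure V K" "gen_curvature V B" and K: "snd ` K \<subseteq> orth_projs"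
  shows "AE z in V. \<forall>i. B z $ i = snd z ** B z $ i + B z $ i ** snd z"
proof -
  have "AE z in V. \<forall>i. snd z ** B z $ i + B z $ i ** snd z - B z $ i = 0"
  proof (rule curvature_tangent_to_constraint[OF assms(1,2)])
    show "((\<lambda>P. P ** P - P) has_derivative (\<lambda>X. P ** X + X ** P - X)) (at P)" for P :: "real^'s^'s"
      by (intro has_derivative_diff matrix_mult.FDERIV has_derivative_ident)
    show "continuous_on UNIV (\<lambda>P. P ** X + X ** P - X)" for X :: "real^'s^'s"
      by (intro continuous_intros matrix_mult.continuous_on)
    show "snd z ** snd z - snd z = 0" if "z \<in> K" for z
      using K that by (auto simp: orth_projs_def)
  qed
  then show ?thesis
    by eventually_elim (metis right_minus_eq)
qed

section \<open>Second fundamental form and flat curvature\<close>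

definition derivative_along_plane ::
    "(real^'s \<Rightarrow> real^'s^'s) \<Rightarrow> (real^'s) \<times> (real^'s^'s) \<Rightarrow> 's::finite \<Rightarrow> real^'s^'s" where
  "derivative_along_plane Q z i = frechet_derivative Q (at (fst z)) (snd z $ i)"

text \<open>The only curvature compatible with a vanishing second fundamental form.\<close>

definition flat_curvature ::
    "(real^'s \<Rightarrow> real^'s^'s) \<Rightarrow> (real^'s) \<times> (real^'s^'s) \<Rightarrow> real^'s^'s^'s" where
  "flat_curvature Q z =
     (\<chi> i. derivative_along_plane Q z i ** snd z + transpose (derivative_along_plane Q z i ** snd z))"

lemma sff_nth:
  assumes "Q differentiable (at (fst z))"
  shows "sff Q B z $ i = transpose ((B z $ i - derivative_along_plane Q z i) ** snd z)"
proof -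
  have "linear (frechet_derivative Q (at (fst z)))"
    using assms by (rule linear_frechet_derivative)
  then have "derivative_along_plane Q z i =
      (\<Sum>q\<in>UNIV. snd z $ i $ q *\<^sub>R frechet_derivative Q (at (fst z)) (axis q 1))"
    unfolding derivative_along_plane_def by (rule linear_vec_expansion)
  then show ?thesis
    by (simp add: sff_def vec_eq_iff transpose_def matrix_matrix_mult_def right_diff_distrib
        sum_subtractf sum_component sum_distrib_left sum_distrib_right mult_ac)
qed

lemma norm_slicewise_transpose: "norm (\<chi> i. transpose (A $ i)) = norm A" for A :: "real^'n^'n^'m"
  by (simp add: norm_vec_def[of A] norm_vec_def[of "\<chi> i. transpose (A $ i)"] norm_transpose)

text \<open>With \<open>X = (B\<^sub>i - D\<^sub>i) P\<close> the transposed second fundamental form, symmetry and the derivation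
  property give \<open>B\<^sub>i = B\<^sub>i P + (B\<^sub>i P)\<^sup>T\<close>, so that \<open>B\<^sub>i\<close> differs from the flat curvature by \<open>X + X\<^sup>T\<close>.\<close>

lemma norm_curvature_minus_flat_le:
  assumes Q: "Q differentiable (at (fst z))" and P: "snd z \<in> orth_projs"
    and symmetric: "\<And>i. transpose (B z $ i) = B z $ i"
    and derivation: "\<And>i. B z $ i = snd z ** B z $ i + B z $ i ** snd z"
  shows "norm (B z - flat_curvature Q z) \<le> 2 * norm (sff Q B z)"
proof -
  have "B z $ i - flat_curvature Q z $ i = sff Q B z $ i + transpose (sff Q B z $ i)" for i
  proof -
    let ?D = "derivative_along_plane Q z i"
    let ?X = "(B z $ i - ?D) ** snd z"
    have "snd z ** B z $ i = transpose (B z $ i ** snd z)"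
      using P symmetric by (simp add: orth_projs_def matrix_transpose_mul)
    then have "B z $ i = transpose (B z $ i ** snd z) + B z $ i ** snd z"
      using derivation by metis
    also have "B z $ i ** snd z = ?X + ?D ** snd z"
      by (simp add: matrix_mult.diff_left)
    also have "transpose (?X + ?D ** snd z) + (?X + ?D ** snd z) = transpose ?X + ?X + flat_curvature Q z $ i"
      by (simp add: flat_curvature_def transpose_add)
    finally show ?thesis
      unfolding sff_nth[OF Q] transpose_transpose by (simp only: diff_eq_eq)
  qed
  then have "B z - flat_curvature Q z = sff Q B z + (\<chi> i. transpose (sff Q B z $ i))"
    by (simp add: vec_eq_iff)
  then show ?thesis
    using norm_triangle_ineq[of "sff Q B z" "\<chi> i. transpose (sff Q B z $ i)"]
    by (simp add: norm_slicewise_transpose)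
qed

lemma sff_flat_curvature_eq_0:
  assumes Q: "Q differentiable (at (fst z))" and P: "snd z \<in> orth_projs"
    and normal: "\<And>i. snd z ** derivative_along_plane Q z i ** snd z = 0"
    and flat: "B z = flat_curvature Q z"
  shows "sff Q B z = 0"
proof -
  have "sff Q B z $ i = 0" for i
  proof -
    let ?P = "snd z" and ?D = "derivative_along_plane Q z i"
    have proj: "?P ** ?P = ?P" "transpose ?P = ?P"
      using P by (simp_all add: orth_projs_def)
    have "B z $ i ** ?P = ?D ** (?P ** ?P) + transpose (?P ** ?D ** ?P)"
      by (simp add: flat flat_curvature_def matrix_mult.add_left matrix_transpose_mul matrix_mul_assoc proj(2))
    then have "(B z $ i - ?D) ** ?P = transpose 0"
      by (simp add: normal proj(1) matrix_mult.diff_left)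
    then show ?thesis
      by (simp add: sff_nth[OF Q] transpose_zero)
  qed
  then show ?thesis
    by (simp add: vec_eq_iff)
qed

lemma continuous_on_flat_curvature:
  assumes Q: "Ck_on 1 U Q" and K: "fst ` K \<subseteq> U"
  shows "continuous_on K (flat_curvature Q)"
  unfolding flat_curvature_def[abs_def] derivative_along_plane_def
  by (intro continuous_on_vec_lambda continuous_intros matrix_mult.continuous_on
      continuous_on_transpose continuous_on_frechet_derivative[OF Q] K)

section \<open>Coercivity of admissible energy densities\<close>

lemma convex_on_ge_linear_outside_sphere:
  fixes f :: "'a::real_normed_vector \<Rightarrow> real"
  assumes f: "convex_on UNIV f" "f 0 = 0" and sphere: "\<And>q. norm q = \<epsilon> \<Longrightarrow> \<mu> \<le> f q"
    and q: "0 < \<epsilon>" "\<epsilon> \<le> norm q"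
  shows "\<mu> * norm q \<le> \<epsilon> * f q"
proof -
  define t where "t = \<epsilon> / norm q"
  have t: "0 \<le> t" "t \<le> 1" "t * norm q = \<epsilon>"
    using q by (auto simp: t_def divide_le_eq_1)
  have "\<mu> \<le> f (t *\<^sub>R q)"
    using t by (intro sphere) simp
  also have "\<dots> \<le> (1 - t) * f 0 + t * f q"
    using convex_onD[OF f(1) t(1,2), of 0 q] by simp
  also have "\<dots> = t * f q"
    by (simp add: f(2))
  finally have "\<mu> * norm q \<le> t * f q * norm q"
    by (rule mult_right_mono) simp
  also have "\<dots> = \<epsilon> * f q"
    unfolding t(3)[symmetric] by simp
  finally show ?thesis .
qed

lemma condFD:
  assumes "condF G F" "z \<in> G"
  shows "0 \<le> F z q" "F z q = 0 \<longleftrightarrow> q = 0" "convex_on UNIV (F z)"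
  using assms by (auto simp: condF_def)

lemma condF_positive_on_sphere:
  assumes F: "condF G F" and G: "compact G" and \<epsilon>: "0 < \<epsilon>"
  obtains \<mu> where "\<mu> > 0" "\<And>z q. z \<in> G \<Longrightarrow> norm q = \<epsilon> \<Longrightarrow> \<mu> \<le> F z q"
proof (cases "G = {}")
  case True
  then show thesis using that[of 1] by simp
next
  case False
  let ?S = "G \<times> sphere (0 :: real^'a^'a^'a) \<epsilon>"
  have "compact ?S"
    by (intro compact_Times G compact_sphere)
  moreover have "?S \<noteq> {}"
    using False \<epsilon> by simp
  moreover have "continuous_on ?S (\<lambda>(z, q). F z q)"
    using F unfolding condF_def by (meson Sigma_mono continuous_on_subset order_refl subset_UNIV)
  ultimately obtain w where w: "w \<in> ?S" "\<And>y. y \<in> ?S \<Longrightarrow> (\<lambda>(z, q). F z q) w \<le> (\<lambda>(z, q). F z q) y"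
    using continuous_attains_inf by metis
  show thesis
  proof (rule that)
    have "fst w \<in> G" "snd w \<noteq> 0"
      using w(1) \<epsilon> by auto
    then show "0 < F (fst w) (snd w)"
      using condFD(1,2)[OF F, of "fst w" "snd w"] by (simp add: less_le)
    show "F (fst w) (snd w) \<le> F z q" if "z \<in> G" "norm q = \<epsilon>" for z q
      using w(2)[of "(z, q)"] that by (simp add: split_beta)
  qed
qed

lemma condF_coercive:
  assumes F: "condF G F" and G: "compact G" and \<epsilon>: "0 < \<epsilon>"
  obtains C where "C > 0" "\<And>z q. z \<in> G \<Longrightarrow> norm q \<le> \<epsilon> + C * F z q"
proof -
  obtain \<mu> where \<mu>: "\<mu> > 0" "\<And>z q. z \<in> G \<Longrightarrow> norm q = \<epsilon> \<Longrightarrow> \<mu> \<le> F z q"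
    using condF_positive_on_sphere[OF F G \<epsilon>] by blast
  have "norm q \<le> \<epsilon> + \<epsilon> / \<mu> * F z q" if z: "z \<in> G" for z q
  proof (cases "\<epsilon> \<le> norm q")
    case True
    have "\<mu> * norm q \<le> \<epsilon> * F z q"
      using condFD[OF F z] \<mu>(2)[OF z] \<epsilon> True by (intro convex_on_ge_linear_outside_sphere) auto
    then have "norm q \<le> \<epsilon> / \<mu> * F z q"
      using \<mu>(1) by (simp add: field_simps)
    then show ?thesis
      using \<epsilon> by linarith
  next
    case False
    moreover have "0 \<le> \<epsilon> / \<mu> * F z q"
      using \<epsilon> \<mu>(1) condFD(1)[OF F z] by simp
    ultimately show ?thesis
      by linarith
  qed
  then show thesis
    using that[of "\<epsilon> / \<mu>"] \<epsilon> \<mu>(1) by simp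
qed

lemma convex_on_norm_squared: "convex_on UNIV (\<lambda>q :: 'a::real_normed_vector. (norm q)\<^sup>2)"
proof (rule convex_onI)
  fix t :: real and x y :: 'a
  assume t: "0 < t" "t < 1"
  have "norm ((1 - t) *\<^sub>R x + t *\<^sub>R y) \<le> (1 - t) * norm x + t * norm y"
    using norm_triangle_ineq[of "(1 - t) *\<^sub>R x" "t *\<^sub>R y"] t by simp
  then have "(norm ((1 - t) *\<^sub>R x + t *\<^sub>R y))\<^sup>2 \<le> ((1 - t) * norm x + t * norm y)\<^sup>2"
    by (intro power_mono) auto
  also have "\<dots> \<le> (1 - t) * (norm x)\<^sup>2 + t * (norm y)\<^sup>2"
    using convex_onD[OF convex_power2, of t "norm x" "norm y"] t by simp
  finally show "(norm ((1 - t) *\<^sub>R x + t *\<^sub>R y))\<^sup>2 \<le> (1 - t) * (norm x)\<^sup>2 + t * (norm y)\<^sup>2" .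
qed simp

lemma condF_norm_squared: "condF G (\<lambda>z q. (norm q)\<^sup>2)"
  unfolding condF_def
proof (intro conjI exI[of _ "\<lambda>z t. t"])
  show "continuous_on (G \<times> UNIV) (\<lambda>(z, q :: real^'a^'a^'a). (norm q)\<^sup>2)"
    "continuous_on (G \<times> {0..}) (\<lambda>(z, t :: real). t)"
    unfolding split_beta by (intro continuous_intros)+
  show "\<forall>z0\<in>G. \<exists>e>0. \<forall>M. \<exists>T. \<forall>t::real\<ge>T. \<forall>z\<in>G \<inter> ball z0 e. M \<le> t"
    using zero_less_one by blast
qed (auto simp: power2_eq_square mono_on_def intro: convex_on_norm_squared[unfolded power2_eq_square])

section \<open>Weak limits of curvatures\<close>

lemma abs_integral_first_variation_le:
  assumes V: "compactly_carried_measure V K" and B: "gen_curvature V B" and H: "continuous_on UNIV H"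
    and \<phi>: "C1c \<phi>" and C: "\<And>z q. z \<in> K \<Longrightarrow> norm (curvature_term \<phi> i z q) \<le> C * norm q"
  shows "\<bar>integral\<^sup>L V (first_variation H \<phi> i)\<bar> \<le> C * (\<integral>z. norm (B z - H z) \<partial>V)"
proof -
  interpret compactly_carried_measure V K by (rule V)
  have integrable: "integrable V B" "integrable V H"
    using B integrable_continuous[OF H] by (simp_all add: gen_curvature_iff)
  note first_variation_integrable = integrable[THEN integrable_first_variation[OF V _ \<phi>]]
  have difference: "first_variation H \<phi> i z - first_variation B \<phi> i z = curvature_term \<phi> i z (H z - B z)" for z
    by (simp add: first_variation_def linear_diff[OF linear_curvature_term[OF \<phi>]])
  have "integral\<^sup>L V (first_variation H \<phi> i)
      = integral\<^sup>L V (first_variation H \<phi> i) - integral\<^sup>L V (first_variation B \<phi> i)"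
    using B \<phi> by (simp add: gen_curvature_iff)
  also have "\<dots> = (\<integral>z. curvature_term \<phi> i z (H z - B z) \<partial>V)"
    unfolding difference[symmetric]
    by (rule Bochner_Integration.integral_diff[symmetric]) (rule first_variation_integrable)+
  also have "\<bar>\<dots>\<bar> \<le> (\<integral>z. norm (curvature_term \<phi> i z (H z - B z)) \<partial>V)"
    using integral_norm_bound[of V "\<lambda>z. curvature_term \<phi> i z (H z - B z)"] by simp
  also have "\<dots> \<le> (\<integral>z. C * norm (B z - H z) \<partial>V)"
  proof (rule integral_mono_AE)
    show "AE z in V. norm (curvature_term \<phi> i z (H z - B z)) \<le> C * norm (B z - H z)"
      using AE_in_carrier by eventually_elim (metis C norm_minus_commute)
    show "integrable V (\<lambda>z. norm (curvature_term \<phi> i z (H z - B z)))"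
      by (intro integrable_norm integrable_curvature_term[OF V _ \<phi>] Bochner_Integration.integrable_diff integrable)
  qed (use integrable in simp)
  finally show ?thesis by simp
qed

lemma gen_curvature_weak_limit:
  assumes V: "\<And>n. compactly_carried_measure (V n) K" and B: "\<And>n. gen_curvature (V n) (B n)"
    and W: "compactly_carried_measure W K" and conv: "weakly_converges V W"
    and H: "continuous_on UNIV H" and deviation: "(\<lambda>n. \<integral>z. norm (B n z - H z) \<partial>V n) \<longlonglongrightarrow> 0"
  shows "gen_curvature W H"
  unfolding gen_curvature_iff
proof (intro conjI allI impI)
  interpret W: compactly_carried_measure W K by (rule W)
  show "integrable W H"
    by (rule W.integrable_continuous[OF H])
  fix \<phi> :: "(real^'a) \<times> (real^'a^'a) \<Rightarrow> real" and i assume \<phi>: "C1c \<phi>"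
  have "continuous_on (K \<times> UNIV) (\<lambda>(z, q). curvature_term \<phi> i z q)"
    unfolding split_beta by (intro continuous_on_curvature_term[OF \<phi>] continuous_intros)
  then obtain C where C: "\<And>z q. z \<in> K \<Longrightarrow> norm (curvature_term \<phi> i z q) \<le> C * norm q"
    by (rule linear_family_bound[OF W.compact_carrier _ linear_curvature_term[OF \<phi>]]) blast
  have "(\<lambda>n. integral\<^sup>L (V n) (first_variation H \<phi> i)) \<longlonglongrightarrow> 0"
  proof (rule Lim_null_comparison)
    show "\<forall>\<^sub>F n in sequentially. norm (integral\<^sup>L (V n) (first_variation H \<phi> i))
        \<le> C * (\<integral>z. norm (B n z - H z) \<partial>V n)"
      using abs_integral_first_variation_le[OF V B H \<phi> C] by simp
    show "(\<lambda>n. C * (\<integral>z. norm (B n z - H z) \<partial>V n)) \<longlonglongrightarrow> 0"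
      using tendsto_mult_left[OF deviation, of C] by simp
  qed
  moreover have "(\<lambda>n. integral\<^sup>L (V n) (first_variation H \<phi> i)) \<longlonglongrightarrow> integral\<^sup>L W (first_variation H \<phi> i)"
    using conv continuous_on_first_variation[OF \<phi> H] by (simp add: weakly_converges_def)
  ultimately show "integral\<^sup>L W (first_variation H \<phi> i) = 0"
    by (rule LIMSEQ_unique[rotated])
qed

lemma (in finite_measure) uniform_measure_space:
  assumes "measure M (space M) > 0"
  shows "uniform_measure M (space M) = density M (\<lambda>_. ennreal (1 / measure M (space M)))"
proof -
  have "1 / emeasure M (space M) = ennreal (1 / measure M (space M))"
    using divide_ennreal[of 1, OF _ assms] by (simp add: emeasure_eq_measure)
  then show ?thesis
    unfolding uniform_measure_def by (intro density_cong) (auto intro!: AE_I2)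
qed

lemma (in finite_measure) integral_uniform_measure_space:
  fixes f :: "'a \<Rightarrow> real"
  assumes "measure M (space M) > 0" "f \<in> borel_measurable M"
  shows "integral\<^sup>L (uniform_measure M (space M)) f = integral\<^sup>L M f / measure M (space M)"
  using assms by (simp add: uniform_measure_space integral_density)

lemma (in compactly_carried_measure) compactly_carried_uniform_measure:
  assumes "measure M (space M) > 0"
  shows "prob_space (uniform_measure M (space M))"
    and "compactly_carried_measure (uniform_measure M (space M)) K"
proof -
  have "emeasure M (space M) \<noteq> 0"
    using assms by (auto simp: measure_def enn2real_positive_iff)
  then show prob: "prob_space (uniform_measure M (space M))"
    by (intro prob_space_uniform_measure) simp_all
  have "AE x in uniform_measure M (space M). x \<in> K"
    using AE_in_carrier by (intro AE_uniform_measureI) auto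
  then show "compactly_carried_measure (uniform_measure M (space M)) K"
    unfolding compactly_carried_measure_def compactly_carried_measure_axioms_def
    using prob_space.finite_measure[OF prob] by (simp add: compact_carrier sets_eq_borel)
qed

lemma gen_curvature_uniform_measure:
  assumes V: "compactly_carried_measure V K" and B: "gen_curvature V B"
    and pos: "measure V (space V) > 0"
  shows "gen_curvature (uniform_measure V (space V)) B"
proof -
  interpret compactly_carried_measure V K by (rule V)
  have integrable: "integrable V B"
    using B by (simp add: gen_curvature_iff)
  have "integrable (uniform_measure V (space V)) B"
    using integrable pos by (simp add: uniform_measure_space integrable_density)
  moreover have "integral\<^sup>L (uniform_measure V (space V)) (first_variation B \<phi> i) = 0" if "C1c \<phi>" for \<phi> i
    using B that borel_measurable_integrable[OF integrable_first_variation[OF V integrable that]] pos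
    by (simp add: integral_uniform_measure_space gen_curvature_iff)
  ultimately show ?thesis
    by (simp add: gen_curvature_iff)
qed

lemma normalized_measure_with_curvature:
  assumes V: "compactly_carried_measure V K" and B: "gen_curvature V B" and H: "continuous_on UNIV H"
    and pos: "measure V (space V) > 0"
    and deviation: "(\<integral>z. norm (B z - H z) \<partial>V) \<le> \<delta> * measure V (space V)"
  shows "\<exists>W. prob_space W \<and> compactly_carried_measure W K \<and> gen_curvature W B \<and>
    (\<integral>z. norm (B z - H z) \<partial>W) \<le> \<delta>"
proof -
  interpret compactly_carried_measure V K by (rule V)
  have "integrable V (\<lambda>z. norm (B z - H z))"
    using B integrable_continuous[OF H] by (simp add: gen_curvature_iff)
  then have "(\<integral>z. norm (B z - H z) \<partial>uniform_measure V (space V)) \<le> \<delta>"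
    using deviation pos by (simp add: integral_uniform_measure_space pos_divide_le_eq)
  then show ?thesis
    using compactly_carried_uniform_measure[OF pos] gen_curvature_uniform_measure[OF V B pos] by blast
qed

lemma prob_with_limit_curvature_exists:
  fixes H :: "(real^'s) \<times> (real^'s^'s) \<Rightarrow> real^'s^'s^'s"
  assumes H: "continuous_on UNIV H"
    and almost: "\<And>\<delta>. \<delta> > 0 \<Longrightarrow> \<exists>V B. prob_space V \<and> compactly_carried_measure V K \<and> gen_curvature V B \<and>
      (\<integral>z. norm (B z - H z) \<partial>V) \<le> \<delta>"
  obtains W where "prob_space W" "compactly_carried_measure W K" "gen_curvature W H"
proof -
  define near where "near \<delta> V B \<longleftrightarrow> prob_space V \<and> compactly_carried_measure V K \<and> gen_curvature V B \<and>
      (\<integral>z. norm (B z - H z) \<partial>V) \<le> \<delta>" for \<delta> V B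
  have "\<exists>V B. near (inverse (real (Suc n))) V B" for n
    unfolding near_def by (rule almost) simp
  then obtain V B where "\<And>n. near (inverse (real (Suc n))) (V n) (B n)"
    by metis
  then have prob: "\<And>n. prob_space (V n)" and V: "\<And>n. compactly_carried_measure (V n) K"
    and B: "\<And>n. gen_curvature (V n) (B n)"
    and deviation: "\<And>n. (\<integral>z. norm (B n z - H z) \<partial>V n) \<le> inverse (real (Suc n))"
    by (simp_all add: near_def)
  have deviation_null: "(\<lambda>n. \<integral>z. norm (B n z - H z) \<partial>V n) \<longlonglongrightarrow> 0"
  proof (rule Lim_null_comparison)
    show "\<forall>\<^sub>F n in sequentially. norm (\<integral>z. norm (B n z - H z) \<partial>V n) \<le> inverse (real (Suc n))"
      using deviation by simp
  qed (rule LIMSEQ_inverse_real_of_nat)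
  obtain r W where r: "strict_mono (r :: nat \<Rightarrow> nat)" and W: "compactly_carried_measure W K" "prob_space W"
    and conv: "weakly_converges (V \<circ> r) W"
    by (rule weak_compactness[OF V prob])
  have "gen_curvature W H"
  proof (rule gen_curvature_weak_limit[where V = "V \<circ> r" and B = "B \<circ> r", OF _ _ W(1) conv H])
    show "(\<lambda>n. \<integral>z. norm ((B \<circ> r) n z - H z) \<partial>(V \<circ> r) n) \<longlonglongrightarrow> 0"
      using LIMSEQ_subseq_LIMSEQ[OF deviation_null r] by (simp add: o_def)
  qed (simp_all add: V B)
  then show thesis
    by (rule that[OF W(2,1)])
qed

section \<open>Mass bounds\<close>

lemma (in finite_measure) integral_le_if_le_nn_integral:
  fixes g :: "'a \<Rightarrow> real"
  assumes g: "integrable M g" and le: "AE x in M. g x \<le> a + c * f x" and c: "c > 0"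
    and f: "(\<integral>\<^sup>+x. ennreal (f x) \<partial>M) \<le> ennreal J" and "0 \<le> J"
  shows "integral\<^sup>L M g \<le> a * measure M (space M) + c * J"
proof -
  have "AE x in M. ennreal ((g x - a) / c) \<le> ennreal (f x)"
    using le by eventually_elim (use c in \<open>auto intro!: ennreal_leI simp: field_simps\<close>)
  then have "(\<integral>\<^sup>+x. ennreal ((g x - a) / c) \<partial>M) \<le> ennreal J"
    using f by (rule order_trans[OF nn_integral_mono_AE])
  then have "(\<integral>x. (g x - a) / c \<partial>M) \<le> J"
    using \<open>0 \<le> J\<close> by (rule integral_real_bounded[rotated])
  moreover have "(\<integral>x. (g x - a) / c \<partial>M) = (integral\<^sup>L M g - a * measure M (space M)) / c"
    using g by (simp add: Bochner_Integration.integral_diff)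
  ultimately show ?thesis
    using c by (simp add: divide_le_eq algebra_simps)
qed

lemma measure_le_if_emeasure_le:
  assumes "emeasure M A \<le> ennreal C * J" "J \<noteq> \<infinity>" "0 \<le> C"
  shows "measure M A \<le> C * enn2real J"
proof -
  have "enn2real (emeasure M A) \<le> enn2real (ennreal C * J)"
    using assms by (intro enn2real_mono) (auto simp: ennreal_mult_less_top top.not_eq_extremum)
  then show ?thesis
    using assms(3) by (simp add: measure_def enn2real_mult)
qed

lemma ennreal_le_mult_if_inverse_mult_le:
  assumes "ennreal (inverse \<eta>) * J \<le> ennreal M" and \<eta>: "0 < \<eta>"
  shows "J \<le> ennreal (\<eta> * M)"
proof -
  have "J = ennreal \<eta> * (ennreal (inverse \<eta>) * J)"
    using \<eta> by (simp add: mult.assoc[symmetric] ennreal_mult[symmetric])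
  also have "\<dots> \<le> ennreal \<eta> * ennreal M"
    using assms(1) by (rule mult_left_mono) simp
  also have "\<dots> = ennreal (\<eta> * M)"
    using \<eta> by (simp add: ennreal_mult')
  finally show ?thesis .
qed

locale tangent_projection =
  fixes Nbar N U :: "(real^'s) set" and Q :: "real^'s \<Rightarrow> real^'s^'s" and m :: nat
  assumes subset: "N \<subseteq> Nbar" and compact: "compact N"
    and neighbourhood: "Nbar \<subseteq> U" and C1: "Ck_on 1 U Q"
    and orth_proj: "\<forall>x\<in>Nbar. is_orth_proj (tangent_space Nbar x) (Q x)"
begin

abbreviation sff_energy ::
    "((real^'s) \<times> (real^'s^'s) \<Rightarrow> real^'s^'s^'s \<Rightarrow> real) \<Rightarrow> ((real^'s) \<times> (real^'s^'s) \<Rightarrow> real^'s^'s^'s) \<Rightarrow>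
      ((real^'s) \<times> (real^'s^'s)) measure \<Rightarrow> ennreal" where
  "sff_energy F B V \<equiv> \<integral>\<^sup>+ z. ennreal (F z (sff Q B z)) \<partial>V"

lemma orth_proj_on_N: "x \<in> N \<Longrightarrow> is_orth_proj (tangent_space Nbar x) (Q x)"
  using orth_proj subset by auto

lemma compact_bundle: "compact (Gm m Nbar N)"
proof (rule compact_Gm[OF orth_proj_on_N compact])
  show "continuous_on N Q"
    using Ck_on_1D(3)[OF C1] subset neighbourhood by (auto intro: continuous_on_subset)
qed

lemma bundleD:
  assumes "z \<in> Gm m Nbar N"
  shows "fst z \<in> U" "Q differentiable (at (fst z))" "snd z \<in> orth_projs"
    "Q (fst z) ** snd z = snd z" "range ((*v) (snd z)) \<subseteq> tangent_space Nbar (fst z)"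
proof -
  show "fst z \<in> U"
    using assms subset neighbourhood by (auto simp: Gm_def)
  then show "Q differentiable (at (fst z))"
    using Ck_on_1D(1)[OF C1] by (auto simp: differentiable_def)
  show "snd z \<in> orth_projs" "range ((*v) (snd z)) \<subseteq> tangent_space Nbar (fst z)"
    using assms by (auto simp: Gm_def Grass_eq)
  show "Q (fst z) ** snd z = snd z"
    using assms mem_Gm_iff[OF orth_proj_on_N, where x = "fst z" and P = "snd z" and m = m] by simp
qed

lemma varifold_iff: "varifold m Nbar N V \<longleftrightarrow> compactly_carried_measure V (Gm m Nbar N)"
proof -
  have "emeasure V (space V - Gm m Nbar N) = 0 \<longleftrightarrow> (AE z in V. z \<in> Gm m Nbar N)" if "sets V = sets borel"
    using borel_compact[OF compact_bundle] that
    by (subst AE_iff_measurable[of "space V - Gm m Nbar N"]) (auto simp: sets_eq_imp_space_eq[OF that])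
  moreover have "finite_measure V \<longleftrightarrow> emeasure V (space V) < \<infinity>"
    by (metis finite_measureI finite_measure.emeasure_finite infinity_ennreal_def less_top)
  ultimately show ?thesis
    unfolding varifold_def compactly_carried_measure_def compactly_carried_measure_axioms_def
    using compact_bundle by blast
qed

lemma normal_derivative_along_plane:
  assumes z: "z \<in> Gm m Nbar N"
  shows "snd z ** derivative_along_plane Q z i ** snd z = 0"
proof (rule projected_derivation_eq_0[where Q = "Q (fst z)"])
  have "fst z \<in> Nbar"
    using z subset by (auto simp: Gm_def)
  then show "transpose (Q (fst z)) = Q (fst z)"
    using orth_proj by (auto simp: is_orth_proj_def)
  have symmetric: "transpose (snd z) = snd z"
    using bundleD(3)[OF z] by (simp add: orth_projs_def)
  then have "snd z $ i = snd z *v axis i 1"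
    by (simp add: matrix_vector_mult_basis column_def transpose_def vec_eq_iff)
  then have "snd z $ i \<in> tangent_space Nbar (fst z)"
    using bundleD(5)[OF z] by auto
  then show "derivative_along_plane Q z i =
      Q (fst z) ** derivative_along_plane Q z i + derivative_along_plane Q z i ** Q (fst z)"
    unfolding derivative_along_plane_def
    using orth_proj Ck_on_1D(1)[OF C1 bundleD(1)[OF z]]
    by (intro tangential_derivative_of_projection) (auto simp: is_orth_proj_def)
  show "Q (fst z) ** snd z = snd z" "transpose (snd z) = snd z"
    using bundleD(4)[OF z] symmetric by simp_all
qed

lemma flat_curvature_continuous_extension:
  obtains H where "continuous_on UNIV H" "\<And>z. z \<in> Gm m Nbar N \<Longrightarrow> H z = flat_curvature Q z"
proof (rule Dugundji[of UNIV UNIV "Gm m Nbar N" "flat_curvature Q"])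
  show "closedin (top_of_set UNIV) (Gm m Nbar N)"
    using compact_bundle by (simp add: compact_imp_closed)
  show "continuous_on (Gm m Nbar N) (flat_curvature Q)"
    using bundleD(1) by (intro continuous_on_flat_curvature[OF C1]) auto
qed (use that in auto)

lemma AE_norm_curvature_minus_flat_le:
  assumes "compactly_carried_measure V (Gm m Nbar N)" "gen_curvature V B"
  shows "AE z in V. norm (B z - flat_curvature Q z) \<le> 2 * norm (sff Q B z)"
proof -
  have "snd ` Gm m Nbar N \<subseteq> orth_projs"
    using bundleD(3) by auto
  note curvature_symmetric[OF assms this] curvature_derivation[OF assms this]
    compactly_carried_measure.AE_in_carrier[OF assms(1)]
  then show ?thesis
  proof eventually_elim
    case (elim z)
    then show ?case
      using bundleD(2,3) by (intro norm_curvature_minus_flat_le) auto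
  qed
qed

lemma curvature_deviation_le_if_energy_le:
  assumes F: "condF (Gm m Nbar N) F" and H: "continuous_on UNIV H"
    and flat: "\<And>z. z \<in> Gm m Nbar N \<Longrightarrow> H z = flat_curvature Q z" and \<delta>: "\<delta> > 0"
  obtains \<eta> where "\<eta> > 0"
    "\<And>V B. varifold m Nbar N V \<Longrightarrow> gen_curvature V B \<Longrightarrow>
      sff_energy F B V \<le> ennreal (\<eta> * measure V (space V)) \<Longrightarrow>
      (\<integral>z. norm (B z - H z) \<partial>V) \<le> \<delta> * measure V (space V)"
proof -
  obtain C where C: "C > 0" and coercive: "\<And>z q. z \<in> Gm m Nbar N \<Longrightarrow> norm q \<le> \<delta> / 4 + C * F z q"
    using condF_coercive[OF F compact_bundle, of "\<delta> / 4"] \<delta> by auto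
  show thesis
  proof (rule that)
    show "\<delta> / (4 * C) > 0"
      using \<delta> C by simp
    fix V :: "((real^'s) \<times> (real^'s^'s)) measure" and B
    let ?mass = "measure V (space V)"
    assume "varifold m Nbar N V" and B: "gen_curvature V B"
      and energy: "sff_energy F B V \<le> ennreal (\<delta> / (4 * C) * ?mass)"
    then have V: "compactly_carried_measure V (Gm m Nbar N)"
      by (simp add: varifold_iff)
    interpret compactly_carried_measure V "Gm m Nbar N" by (rule V)
    have "AE z in V. norm (B z - H z) \<le> \<delta> / 2 + 2 * C * F z (sff Q B z)"
      using AE_norm_curvature_minus_flat_le[OF V B] AE_in_carrier
    proof eventually_elim
      case (elim z)
      then show ?case
        using coercive[of z "sff Q B z"] by (simp add: flat)
    qed
    moreover have "integrable V (\<lambda>z. norm (B z - H z))"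
      using B integrable_continuous[OF H] by (simp add: gen_curvature_iff)
    ultimately have "(\<integral>z. norm (B z - H z) \<partial>V) \<le> \<delta> / 2 * ?mass + 2 * C * (\<delta> / (4 * C) * ?mass)"
      using C \<delta> energy by (intro integral_le_if_le_nn_integral) auto
    then show "(\<integral>z. norm (B z - H z) \<partial>V) \<le> \<delta> * ?mass"
      using C by simp
  qed
qed

lemma null_varifold_if_flat_curvature:
  assumes W: "prob_space W" "compactly_carried_measure W (Gm m Nbar N)" "gen_curvature W H"
    and flat: "\<And>z. z \<in> Gm m Nbar N \<Longrightarrow> H z = flat_curvature Q z"
  shows "varifold m Nbar N W \<and> emeasure W (space W) \<noteq> 0 \<and> gen_curvature W H \<and> (AE z in W. sff Q H z = 0)"
proof -
  have "AE z in W. sff Q H z = 0"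
    using compactly_carried_measure.AE_in_carrier[OF W(2)]
  proof eventually_elim
    case (elim z)
    then show ?case
      by (intro sff_flat_curvature_eq_0 bundleD(2,3) normal_derivative_along_plane flat)
  qed
  then show ?thesis
    using W prob_space.emeasure_space_1[OF W(1)] by (simp add: varifold_iff)
qed

text \<open>Without a bound by the energy there are varifolds whose curvature is, relative to their mass, as
  close to the flat one as desired; a weak limit of their normalizations is a null varifold.\<close>

lemma mass_le_energy_if_no_null_varifold:
  assumes no_null: "\<nexists>V B. varifold m Nbar N V \<and> emeasure V (space V) \<noteq> 0 \<and> gen_curvature V B \<and>
      (AE z in V. sff Q B z = 0)"
    and F: "condF (Gm m Nbar N) F"
  shows "\<exists>C>0. \<forall>V B. varifold m Nbar N V \<and> gen_curvature V B \<longrightarrow>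
      emeasure V (space V) \<le> ennreal C * sff_energy F B V"
proof (rule ccontr)
  assume no_bound: "\<not> ?thesis"
  obtain H where H: "continuous_on UNIV H" and flat: "\<And>z. z \<in> Gm m Nbar N \<Longrightarrow> H z = flat_curvature Q z"
    using flat_curvature_continuous_extension by blast
  have "\<exists>V B. prob_space V \<and> compactly_carried_measure V (Gm m Nbar N) \<and> gen_curvature V B \<and>
      (\<integral>z. norm (B z - H z) \<partial>V) \<le> \<delta>" if \<delta>: "\<delta> > 0" for \<delta>
  proof -
    obtain \<eta> where \<eta>: "\<eta> > 0" and deviation: "\<And>V B. varifold m Nbar N V \<Longrightarrow> gen_curvature V B \<Longrightarrow>
        sff_energy F B V \<le> ennreal (\<eta> * measure V (space V)) \<Longrightarrow>
        (\<integral>z. norm (B z - H z) \<partial>V) \<le> \<delta> * measure V (space V)"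
      using curvature_deviation_le_if_energy_le[OF F H flat \<delta>] by blast
    obtain V B where V: "varifold m Nbar N V" and B: "gen_curvature V B"
      and large: "ennreal (inverse \<eta>) * sff_energy F B V < emeasure V (space V)"
      using no_bound \<eta> by (meson positive_imp_inverse_positive not_le)
    interpret compactly_carried_measure V "Gm m Nbar N"
      using V by (simp add: varifold_iff)
    have pos: "measure V (space V) > 0"
      using le_less_trans[OF zero_le large] by (simp add: emeasure_eq_measure)
    have "sff_energy F B V \<le> ennreal (\<eta> * measure V (space V))"
      using large \<eta> by (intro ennreal_le_mult_if_inverse_mult_le) (simp_all add: emeasure_eq_measure)
    then have "(\<integral>z. norm (B z - H z) \<partial>V) \<le> \<delta> * measure V (space V)"
      by (rule deviation[OF V B])
    then show ?thesis
      using V normalized_measure_with_curvature[OF _ B H pos] unfolding varifold_iff by blast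
  qed
  then obtain W where "prob_space W" "compactly_carried_measure W (Gm m Nbar N)" "gen_curvature W H"
    by (rule prob_with_limit_curvature_exists[OF H])
  then show False
    using null_varifold_if_flat_curvature[OF _ _ _ flat] no_null by blast
qed

lemma sff_energy_eq_0:
  assumes F: "condF (Gm m Nbar N) F" and V: "varifold m Nbar N V" and null: "AE z in V. sff Q B z = 0"
  shows "sff_energy F B V = 0"
proof -
  have "AE z in V. z \<in> Gm m Nbar N"
    using V by (simp add: varifold_iff compactly_carried_measure.AE_in_carrier)
  with null have "AE z in V. ennreal (F z (sff Q B z)) = 0"
    by eventually_elim (simp add: condFD(2)[OF F, THEN iffD2])
  then have "sff_energy F B V = (\<integral>\<^sup>+z. 0 \<partial>V)"
    by (rule nn_integral_cong_AE)
  then show ?thesis by simp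
qed

lemma null_varifold_eq_0_if_mass_le_energy:
  assumes F: "condF (Gm m Nbar N) F" and V: "varifold m Nbar N V" and null: "AE z in V. sff Q B z = 0"
    and "\<Phi> 0 = 0" and bound: "sff_energy F B V \<noteq> \<infinity> \<Longrightarrow> measure V (space V) \<le> \<Phi> (enn2real (sff_energy F B V))"
  shows "emeasure V (space V) = 0"
proof -
  have "measure V (space V) \<le> 0"
    using bound \<open>\<Phi> 0 = 0\<close> by (simp add: sff_energy_eq_0[OF F V null])
  moreover have "emeasure V (space V) = ennreal (measure V (space V))"
    using V by (intro emeasure_eq_ennreal_measure) (auto simp: varifold_def)
  ultimately show ?thesis
    by (simp add: ennreal_neg)
qed

end

theorem theorem4p1:
  fixes Nbar N U0 :: "(real^'s) set"
    and Q :: "real^'s \<Rightarrow> real^'s^'s"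
    and m :: nat
  assumes Nbar: "embedded_submanifold TYPE('n::finite) Nbar"
    and NsubNbar: "N \<subseteq> Nbar" and Ncompact: "compact N"
    and m_ge: "1 \<le> m" and m_le: "m \<le> CARD('n) - 1"
    and O_open: "open U0" and O_sup: "Nbar \<subseteq> U0" and Q_C1: "Ck_on 1 U0 Q"
    and Q_proj: "\<forall>x\<in>Nbar. is_orth_proj (tangent_space Nbar x) (Q x)"
  shows
   "((\<not> (\<exists>V B. varifold m Nbar N V \<and> emeasure V (space V) \<noteq> 0 \<and> gen_curvature V B \<and>
              (AE z in V. sff Q B z = 0)))
     \<longleftrightarrow>
     (\<exists>(\<Phi>::real \<Rightarrow> real) F.
        mono_on {0..} \<Phi> \<and> \<Phi> 0 = 0 \<and> (\<forall>t\<ge>0. \<Phi> t \<ge> 0) \<and> condF (Gm m Nbar N) F \<and>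
        (\<forall>V B. varifold m Nbar N V \<and> gen_curvature V B \<longrightarrow>
           (\<integral>\<^sup>+ z. ennreal (F z (sff Q B z)) \<partial>V) \<noteq> \<infinity> \<longrightarrow>
           measure V (space V) \<le> \<Phi> (enn2real (\<integral>\<^sup>+ z. ennreal (F z (sff Q B z)) \<partial>V)))))
    \<and>
    ((\<exists>(\<Phi>::real \<Rightarrow> real) F.
        mono_on {0..} \<Phi> \<and> \<Phi> 0 = 0 \<and> (\<forall>t\<ge>0. \<Phi> t \<ge> 0) \<and> condF (Gm m Nbar N) F \<and>
        (\<forall>V B. varifold m Nbar N V \<and> gen_curvature V B \<longrightarrow>
           (\<integral>\<^sup>+ z. ennreal (F z (sff Q B z)) \<partial>V) \<noteq> \<infinity> \<longrightarrow>
           measure V (space V) \<le> \<Phi> (enn2real (\<integral>\<^sup>+ z. ennreal (F z (sff Q B z)) \<partial>V))))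
     \<longleftrightarrow>
     (\<forall>F. condF (Gm m Nbar N) F \<longrightarrow>
        (\<exists>C>0. \<forall>V B. varifold m Nbar N V \<and> gen_curvature V B \<longrightarrow>
           emeasure V (space V) \<le> ennreal C * (\<integral>\<^sup>+ z. ennreal (F z (sff Q B z)) \<partial>V))))"
    (is "(?I \<longleftrightarrow> ?II) \<and> (?II \<longleftrightarrow> ?III)")
proof -
  interpret tangent_projection Nbar N U0 Q m
    by unfold_locales fact+
  have "?I \<Longrightarrow> ?III"
    using mass_le_energy_if_no_null_varifold by blast
  moreover have "?II" if III: "?III"
  proof -
    obtain C where C: "C > 0" and bound: "\<And>V B. varifold m Nbar N V \<Longrightarrow> gen_curvature V B \<Longrightarrow>
        emeasure V (space V) \<le> ennreal C * sff_energy (\<lambda>z q. (norm q)\<^sup>2) B V"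
      using III condF_norm_squared by blast
    have "mono_on {0..} ((*) C)"
      using C by (simp add: mono_on_def)
    with C bound show ?thesis
      by (intro exI[of _ "(*) C"] exI[of _ "\<lambda>z q. (norm q)\<^sup>2"])
        (auto intro!: condF_norm_squared measure_le_if_emeasure_le)
  qed
  moreover have "?I" if II: "?II"
    using II null_varifold_eq_0_if_mass_le_energy by blast
  ultimately show ?thesis by blast
qed

end
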